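(* There is a function $\varepsilon(n)\to 0$ as $n\to\infty$ such that for every $n\ge 2$, every complete $n$-vertex simple topological graph contains a plane path of length at least $(\log n)^{1 -\varepsilon(n)}$.
   Context: A topological graph is a graph drawn in the plane with vertices as points and edges as non-self-intersecting arcs connecting the corresponding points; arcs do not pass through vertices other than their endpoints, and if two edges share an interior point they properly cross there. It is simple if every pair of edges intersect at most once, either at a common endpoint or at a proper crossing. A plane path is a path in the graph no two of whose edges cross. Logarithms are base 2. *)

theory Defs
  imports "HOL-Analysis.Analysis"
begin

definition arc_interior :: "(real \<Rightarrow> complex) \<Rightarrow> complex set" where
  "arc_interior g = path_image g - {pathstart g, pathfinish g}"

text \<open>
  A proper crossing is a transversal intersection in the topological sense: up to a homeomorphism
  of a neighbourhood of the point, the two arcs look like the two coordinate axes of a disc.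
\<close>

definition properly_cross_at :: "complex \<Rightarrow> (real \<Rightarrow> complex) \<Rightarrow> (real \<Rightarrow> complex) \<Rightarrow> bool" where
  "properly_cross_at p g h \<longleftrightarrow>
     p \<in> arc_interior g \<and> p \<in> arc_interior h \<and>
     (\<exists>U \<phi> \<psi>. open U \<and> p \<in> U \<and> homeomorphism U (ball (0::complex) 1) \<phi> \<psi> \<and> \<phi> p = 0 \<and>
        \<phi> ` (U \<inter> path_image g) = {z \<in> ball 0 1. Im z = 0} \<and>
        \<phi> ` (U \<inter> path_image h) = {z \<in> ball 0 1. Re z = 0})"

definition cross :: "(real \<Rightarrow> complex) \<Rightarrow> (real \<Rightarrow> complex) \<Rightarrow> bool" where
  "cross g h \<longleftrightarrow> (\<exists>p. properly_cross_at p g h)"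

text \<open>
  The plane is the type \<^typ>\<open>complex\<close>. Vertices are identified with the points representing them,
  an edge is the set of its two endpoints, and \<open>\<gamma> e\<close> parametrises the arc drawn for the edge \<open>e\<close>,
  in either direction.
\<close>

locale topological_graph =
  fixes V :: "complex set" and E :: "complex set set" and \<gamma> :: "complex set \<Rightarrow> real \<Rightarrow> complex"
  assumes finite_vertices: "finite V"
    and edges_subset: "E \<subseteq> {e. e \<subseteq> V \<and> card e = 2}"
    and arc_edge: "e \<in> E \<Longrightarrow> arc (\<gamma> e)"
    and endpoints_edge: "e \<in> E \<Longrightarrow> {pathstart (\<gamma> e), pathfinish (\<gamma> e)} = e"
    and vertices_on_edge: "e \<in> E \<Longrightarrow> path_image (\<gamma> e) \<inter> V \<subseteq> e"
    and proper_crossing: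
      "\<lbrakk>e \<in> E; f \<in> E; e \<noteq> f; p \<in> arc_interior (\<gamma> e); p \<in> arc_interior (\<gamma> f)\<rbrakk>
        \<Longrightarrow> properly_cross_at p (\<gamma> e) (\<gamma> f)"

locale simple_topological_graph = topological_graph +
  assumes intersect_at_most_once:
    "\<lbrakk>e \<in> E; f \<in> E; e \<noteq> f; p \<in> path_image (\<gamma> e) \<inter> path_image (\<gamma> f);
      q \<in> path_image (\<gamma> e) \<inter> path_image (\<gamma> f)\<rbrakk> \<Longrightarrow> p = q"

lemma (in topological_graph) intersection_cases:
  assumes "e \<in> E" "f \<in> E" "e \<noteq> f" "p \<in> path_image (\<gamma> e) \<inter> path_image (\<gamma> f)"
  shows "p \<in> e \<inter> f \<or> properly_cross_at p (\<gamma> e) (\<gamma> f)"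
proof (cases "p \<in> V")
  case True
  then show ?thesis
    using assms vertices_on_edge by blast
next
  case False
  then have "p \<notin> e" "p \<notin> f"
    using assms edges_subset by blast+
  then have "p \<in> arc_interior (\<gamma> e)" "p \<in> arc_interior (\<gamma> f)"
    using assms endpoints_edge[of e] endpoints_edge[of f] by (auto simp: arc_interior_def)
  then show ?thesis
    using assms proper_crossing by blast
qed

definition complete_edges :: "complex set \<Rightarrow> complex set set" where
  "complete_edges V = {e. e \<subseteq> V \<and> card e = 2}"

text \<open>A path in the graph is given by the list of its vertices; its length is its number of edges.\<close>

definition path_edges :: "complex list \<Rightarrow> complex set set" where
  "path_edges vs = {{vs ! i, vs ! Suc i} | i. Suc i < length vs}"

definition graph_path :: "complex set \<Rightarrow> complex set set \<Rightarrow> complex list \<Rightarrow> bool" where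
  "graph_path V E vs \<longleftrightarrow> vs \<noteq> [] \<and> distinct vs \<and> set vs \<subseteq> V \<and> path_edges vs \<subseteq> E"

definition graph_path_length :: "complex list \<Rightarrow> nat" where
  "graph_path_length vs = length vs - 1"

definition plane_path ::
  "complex set \<Rightarrow> complex set set \<Rightarrow> (complex set \<Rightarrow> real \<Rightarrow> complex) \<Rightarrow> complex list \<Rightarrow> bool" where
  "plane_path V E \<gamma> vs \<longleftrightarrow>
     graph_path V E vs \<and>
     (\<forall>e \<in> path_edges vs. \<forall>f \<in> path_edges vs. e \<noteq> f \<longrightarrow> \<not> cross (\<gamma> e) (\<gamma> f))"

end

theory Submission
  imports Defs "HOL-Real_Asymp.Real_Asymp"
begin

text \<open>
  Fix a vertex \<open>v\<close>. By Jordan curve parity, an edge whose ends lie on the same side of a triangle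
  \<open>v a b\<close> and which crosses neither \<open>v a\<close> nor \<open>v b\<close> does not cross \<open>a b\<close>. So a plane path can be
  built greedily: at its current end \<open>a\<close> one keeps a set \<open>S\<close> of candidates, passes to a subset spanning
  no edge that crosses \<open>v a\<close>, picks the next vertex \<open>b\<close> there, and keeps the larger of the two sides of
  the triangle \<open>v a b\<close>.

  The relation ``the edge \<open>k l\<close> crosses \<open>v a\<close>'' is the comparability relation of a partial order: the
  triangles \<open>v a k\<close> are nested along \<open>v a\<close>, and transitivity holds because otherwise three crossings
  would have to be distributed over two copies of \<open>K\<^sub>4\<close>, each of which has at most one crossing. Hence
  either \<open>S\<close> has an independent subset of size \<open>|S| / t\<close>, or there is a chain of length \<open>t\<close>. In a chain
  \<open>w\<^sub>1 < w\<^sub>2 < w\<^sub>3 < w\<^sub>4\<close> the edges \<open>w\<^sub>1 w\<^sub>3\<close> and \<open>w\<^sub>2 w\<^sub>4\<close> never cross, so the zigzag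
  \<open>x\<^sub>1, x\<^sub>m\<^sub>+\<^sub>1, x\<^sub>2, x\<^sub>m\<^sub>+\<^sub>2, \<dots>\<close> through a chain of length \<open>2 m\<close> is a plane path. Choosing \<open>t = 2 r\<close>
  yields a plane path of length \<open>r\<close> as soon as \<open>n \<ge> (8 r)\<^sup>r + 2\<close>.
\<close>

section \<open>Arcs and Jordan curves\<close>

text \<open>Arcs are kept as point sets with two named ends, so that halves of edges can be split
  off, reversed and glued without tracking parametrisations.\<close>

definition arc_between :: "complex set \<Rightarrow> complex \<Rightarrow> complex \<Rightarrow> bool" where
  "arc_between S x y \<longleftrightarrow> (\<exists>g. arc g \<and> path_image g = S \<and> pathstart g = x \<and> pathfinish g = y)"

definition jordan_curve :: "complex set \<Rightarrow> bool" where
  "jordan_curve J \<longleftrightarrow> (\<exists>c. simple_path c \<and> pathfinish c = pathstart c \<and> path_image c = J)"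

lemma arc_between_sym: "arc_between S x y \<Longrightarrow> arc_between S y x"
  unfolding arc_between_def
  by (metis arc_reversepath path_image_reversepath pathfinish_reversepath pathstart_reversepath)

lemma arc_between_endpoints:
  assumes "arc_between S x y"
  shows "x \<in> S" "y \<in> S" "x \<noteq> y"
  using assms arc_distinct_ends unfolding arc_between_def by fastforce+

lemma arc_between_closed: "arc_between S x y \<Longrightarrow> closed S"
  unfolding arc_between_def using closed_arc_image by blast

lemma arc_between_connected:
  assumes "arc_between S x y"
  shows "connected S" "connected (S - {x})" "connected (S - {y})" "connected (S - {x, y})"
proof -
  obtain g where g: "arc g" "path_image g = S" "pathstart g = x" "pathfinish g = y"
    using assms unfolding arc_between_def by blast
  have cont: "continuous_on {0..1} g" and inj: "inj_on g {0..1}"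
    using g by (auto simp: arc_def path_def)
  have S: "S = g ` {0..1}" and x: "x = g 0" and y: "y = g 1"
    using g by (auto simp: path_image_def pathstart_def pathfinish_def)
  show "connected S"
    using g by (metis connected_arc_image)
  have "S - {x} = g ` {0<..1}"
    using inj unfolding S x inj_on_def by (force simp: less_le)
  moreover have "continuous_on {0<..1} g"
    using cont by (rule continuous_on_subset) auto
  ultimately show "connected (S - {x})"
    by (metis connected_Ioc connected_continuous_image)
  have "S - {y} = g ` {0..<1}"
    using inj unfolding S y inj_on_def by (force simp: less_le)
  moreover have "continuous_on {0..<1} g"
    using cont by (rule continuous_on_subset) auto
  ultimately show "connected (S - {y})"
    by (metis connected_Ico connected_continuous_image)
  show "connected (S - {x, y})"
    using g by (metis arc_imp_simple_path connected_simple_path_endless)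
qed

lemma arc_between_split_param:
  assumes "arc g" "0 < t" "t < 1"
  shows "arc_between (g ` {0..t}) (pathstart g) (g t)"
    and "arc_between (g ` {t..1}) (g t) (pathfinish g)"
    and "g ` {0..t} \<union> g ` {t..1} = path_image g"
    and "g ` {0..t} \<inter> g ` {t..1} = {g t}"
proof -
  have inj: "inj_on g {0..1}"
    using assms by (simp add: arc_def)
  show "arc_between (g ` {0..t}) (pathstart g) (g t)"
    unfolding arc_between_def using assms
    by (intro exI[of _ "subpath 0 t g"] conjI arc_subpath_arc)
      (auto simp: path_image_subpath, auto simp: pathstart_def pathfinish_def)
  show "arc_between (g ` {t..1}) (g t) (pathfinish g)"
    unfolding arc_between_def using assms
    by (intro exI[of _ "subpath t 1 g"] conjI arc_subpath_arc)
      (auto simp: path_image_subpath, auto simp: pathstart_def pathfinish_def)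
  show "g ` {0..t} \<union> g ` {t..1} = path_image g"
    using assms unfolding path_image_def by (subst image_Un[symmetric]) (auto intro!: arg_cong[of _ _ "image g"])
  have "g ` {0..t} \<inter> g ` {t..1} = g ` ({0..t} \<inter> {t..1})"
    using inj assms by (intro inj_on_image_Int[symmetric, OF inj]) auto
  also have "{0..t} \<inter> {t..1} = {t}"
    using assms by auto
  finally show "g ` {0..t} \<inter> g ` {t..1} = {g t}"
    by simp
qed

lemma arc_between_split:
  assumes "arc_between S x y" "p \<in> S" "p \<noteq> x" "p \<noteq> y"
  obtains S1 S2 where "arc_between S1 x p" "arc_between S2 p y" "S1 \<union> S2 = S" "S1 \<inter> S2 = {p}"
proof -
  obtain g where g: "arc g" "path_image g = S" "pathstart g = x" "pathfinish g = y"
    using assms unfolding arc_between_def by blast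
  obtain t where t: "t \<in> {0..1}" "g t = p"
    using assms g by (auto simp: path_image_def)
  have "t \<noteq> 0" "t \<noteq> 1"
    using assms g t by (auto simp: pathstart_def pathfinish_def)
  then have "0 < t" "t < 1"
    using t by auto
  from arc_between_split_param[OF g(1) this] show ?thesis
    using that g t by blast
qed

lemma jordan_curve_triangle:
  assumes "arc_between A x y" "arc_between B y z" "arc_between C z x"
    and "A \<inter> B = {y}" "B \<inter> C = {z}" "C \<inter> A = {x}"
  shows "jordan_curve (A \<union> B \<union> C)"
proof -
  obtain f where f: "arc f" "path_image f = A" "pathstart f = x" "pathfinish f = y"
    using assms unfolding arc_between_def by blast
  obtain g where g: "arc g" "path_image g = B" "pathstart g = y" "pathfinish g = z"
    using assms unfolding arc_between_def by blast
  obtain h where h: "arc h" "path_image h = C" "pathstart h = z" "pathfinish h = x"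
    using assms unfolding arc_between_def by blast
  have fg: "arc (f +++ g)"
    using f g assms by (intro arc_join) auto
  have im: "path_image (f +++ g) = A \<union> B"
    using f g by (simp add: path_image_join)
  have "simple_path ((f +++ g) +++ h)"
    using fg f g h im assms by (intro simple_path_join_loop) auto
  moreover have "path_image ((f +++ g) +++ h) = A \<union> B \<union> C"
    using f g h im by (subst path_image_join) auto
  ultimately show ?thesis
    unfolding jordan_curve_def using f h by (intro exI[of _ "(f +++ g) +++ h"]) auto
qed

lemma jordan_curve_sides:
  assumes "jordan_curve J"
  shows "open (inside J)" "connected (inside J)" "open (outside J)" "connected (outside J)"
    "inside J \<union> outside J = - J" "frontier (inside J) = J" "frontier (outside J) = J"
proof -
  obtain c where "simple_path c" "pathfinish c = pathstart c" "path_image c = J"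
    using assms unfolding jordan_curve_def by blast
  then show "open (inside J)" "connected (inside J)" "open (outside J)" "connected (outside J)"
    "inside J \<union> outside J = - J" "frontier (inside J) = J" "frontier (outside J) = J"
    using Jordan_inside_outside[of c] by simp_all
qed

lemma jordan_curve_meets_sides:
  assumes "jordan_curve J" "p \<in> J" "open N" "p \<in> N"
  shows "N \<inter> inside J \<noteq> {}" "N \<inter> outside J \<noteq> {}"
proof -
  have "p \<in> closure (inside J)" "p \<in> closure (outside J)"
    using jordan_curve_sides[OF assms(1)] assms(2) by (auto simp: frontier_def)
  then show "N \<inter> inside J \<noteq> {}" "N \<inter> outside J \<noteq> {}"
    using assms(4) open_Int_closure_eq_empty[OF assms(3)] by blast+
qed

text \<open>The inside of a set is a union of components of its complement, so this holds for an
  arbitrary set \<open>J\<close>.\<close>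

lemma connected_same_side:
  assumes "connected C" "C \<inter> J = {}" "x \<in> C" "y \<in> C"
  shows "x \<in> inside J \<longleftrightarrow> y \<in> inside J"
proof -
  have "connected_component (- J) x y" "connected_component (- J) y x"
    using assms unfolding connected_component_def by blast+
  then show ?thesis
    using inside_same_component by blast
qed

section \<open>Proper crossings\<close>

lemma properly_cross_at_sym:
  assumes "properly_cross_at p g h"
  shows "properly_cross_at p h g"
proof -
  obtain U \<phi> \<psi> where U: "open U" "p \<in> U" "homeomorphism U (ball (0::complex) 1) \<phi> \<psi>" "\<phi> p = 0"
    and g: "\<phi> ` (U \<inter> path_image g) = {z \<in> ball 0 1. Im z = 0}"
    and h: "\<phi> ` (U \<inter> path_image h) = {z \<in> ball 0 1. Re z = 0}"
    and p: "p \<in> arc_interior g" "p \<in> arc_interior h"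
    using assms unfolding properly_cross_at_def by blast
  \<comment> \<open>The definition assigns the real axis to \<open>g\<close> and the imaginary axis
    to \<open>h\<close>; composing the chart with multiplication by \<open>\<i>\<close> exchanges
    them.\<close>
  have rot: "homeomorphism (ball (0::complex) 1) (ball 0 1) (\<lambda>z. \<i> * z) (\<lambda>z. - \<i> * z)"
    by (rule homeomorphismI) (auto simp: norm_mult intro!: continuous_intros)
  have hom: "homeomorphism U (ball 0 1) ((\<lambda>z. \<i> * z) \<circ> \<phi>) (\<psi> \<circ> (\<lambda>z. - \<i> * z))"
    by (rule homeomorphism_compose[OF U(3) rot])
  have im1: "(\<lambda>z. \<i> * z) ` {z \<in> ball 0 1. Im z = 0} = {z \<in> ball 0 1. Re z = 0}"
  proof (intro equalityI subsetI)
    fix z :: complex assume "z \<in> {z \<in> ball 0 1. Re z = 0}"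
    then show "z \<in> (\<lambda>z. \<i> * z) ` {z \<in> ball 0 1. Im z = 0}"
      by (intro image_eqI[of _ _ "- \<i> * z"]) (auto simp: norm_mult)
  qed (auto simp: norm_mult)
  have im2: "(\<lambda>z. \<i> * z) ` {z \<in> ball 0 1. Re z = 0} = {z \<in> ball 0 1. Im z = 0}"
  proof (intro equalityI subsetI)
    fix z :: complex assume "z \<in> {z \<in> ball 0 1. Im z = 0}"
    then show "z \<in> (\<lambda>z. \<i> * z) ` {z \<in> ball 0 1. Re z = 0}"
      by (intro image_eqI[of _ _ "- \<i> * z"]) (auto simp: norm_mult)
  qed (auto simp: norm_mult)
  have "((\<lambda>z. \<i> * z) \<circ> \<phi>) ` (U \<inter> path_image h) = {z \<in> ball 0 1. Im z = 0}"
    "((\<lambda>z. \<i> * z) \<circ> \<phi>) ` (U \<inter> path_image g) = {z \<in> ball 0 1. Re z = 0}"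
    "((\<lambda>z. \<i> * z) \<circ> \<phi>) p = 0"
    using g h im1 im2 U by (simp_all only: image_comp[symmetric] comp_apply mult_zero_right)
  then show ?thesis
    unfolding properly_cross_at_def using U(1,2) p hom by blast
qed

lemma properly_cross_at_reversepath:
  "properly_cross_at p (reversepath g) h \<longleftrightarrow> properly_cross_at p g h"
  "properly_cross_at p g (reversepath h) \<longleftrightarrow> properly_cross_at p g h"
  unfolding properly_cross_at_def arc_interior_def by (simp_all add: insert_commute)

text \<open>The chart of a proper crossing is restricted to the preimage of a small disc, so that it
  fits into a prescribed neighbourhood \<open>W\<close>; the two arcs are still the coordinate
  axes.\<close>

lemma properly_cross_at_chart:
  assumes "properly_cross_at p g h" "open W" "p \<in> W"
  obtains N \<phi> \<psi> r where "open N" "p \<in> N" "N \<subseteq> W" "0 < r" "\<phi> p = 0"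
    "continuous_on N \<phi>" "continuous_on (ball 0 r) \<psi>" "inj_on \<phi> N"
    "\<And>z. z \<in> N \<Longrightarrow> \<phi> z \<in> ball (0::complex) r \<and> \<psi> (\<phi> z) = z"
    "\<And>w. w \<in> ball 0 r \<Longrightarrow> \<psi> w \<in> N \<and> \<phi> (\<psi> w) = w"
    "\<And>z. z \<in> N \<Longrightarrow> z \<in> path_image g \<longleftrightarrow> Im (\<phi> z) = 0"
    "\<And>z. z \<in> N \<Longrightarrow> z \<in> path_image h \<longleftrightarrow> Re (\<phi> z) = 0"
proof -
  obtain U \<phi> \<psi> where U: "open U" "p \<in> U" "homeomorphism U (ball (0::complex) 1) \<phi> \<psi>" "\<phi> p = 0"
    and g: "\<phi> ` (U \<inter> path_image g) = {z \<in> ball 0 1. Im z = 0}"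
    and h: "\<phi> ` (U \<inter> path_image h) = {z \<in> ball 0 1. Re z = 0}"
    using assms(1) unfolding properly_cross_at_def by blast
  have c\<phi>: "continuous_on U \<phi>" and c\<psi>: "continuous_on (ball 0 1) \<psi>"
    and \<phi>U: "\<And>z. z \<in> U \<Longrightarrow> \<phi> z \<in> ball 0 1 \<and> \<psi> (\<phi> z) = z"
    and \<psi>B: "\<And>w. w \<in> ball 0 1 \<Longrightarrow> \<psi> w \<in> U \<and> \<phi> (\<psi> w) = w"
    using U(3) unfolding homeomorphism_def by auto
  have inj: "inj_on \<phi> U"
    by (metis \<phi>U inj_onI)
  have "\<psi> 0 = p"
    using \<phi>U[OF U(2)] U(4) by simp
  moreover have "open (ball 0 1 \<inter> \<psi> -` W)"
    using c\<psi> assms(2) by (simp add: continuous_open_preimage)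
  ultimately obtain r where r: "0 < r" "ball 0 r \<subseteq> ball 0 1 \<inter> \<psi> -` W"
    using assms(3) by (metis IntI centre_in_ball open_contains_ball_eq vimageI zero_less_one)
  define N where "N = U \<inter> \<phi> -` ball 0 r"
  have "open N"
    unfolding N_def using c\<phi> U(1) by (simp add: continuous_open_preimage)
  moreover have "p \<in> N"
    using U r by (simp add: N_def)
  moreover have "N \<subseteq> W"
    unfolding N_def using r \<phi>U by fastforce
  moreover have "continuous_on N \<phi>" "continuous_on (ball 0 r) \<psi>"
    using c\<phi> c\<psi> r by (auto simp: N_def intro: continuous_on_subset)
  moreover have "inj_on \<phi> N"
    using inj by (rule inj_on_subset) (simp add: N_def)
  moreover have "\<phi> z \<in> ball 0 r \<and> \<psi> (\<phi> z) = z" if "z \<in> N" for z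
    using that \<phi>U by (auto simp: N_def)
  moreover have "\<psi> w \<in> N \<and> \<phi> (\<psi> w) = w" if "w \<in> ball 0 r" for w
    using that r \<psi>B[of w] by (auto simp: N_def)
  moreover have "z \<in> path_image g \<longleftrightarrow> Im (\<phi> z) = 0" if "z \<in> N" for z
  proof -
    have z: "z \<in> U" "\<phi> z \<in> ball 0 1" using that \<phi>U by (auto simp: N_def)
    have "z \<in> path_image g \<longleftrightarrow> \<phi> z \<in> \<phi> ` (U \<inter> path_image g)"
      using inj z by (auto simp: inj_on_def)
    then show ?thesis using g z by simp
  qed
  moreover have "z \<in> path_image h \<longleftrightarrow> Re (\<phi> z) = 0" if "z \<in> N" for z
  proof -
    have z: "z \<in> U" "\<phi> z \<in> ball 0 1" using that \<phi>U by (auto simp: N_def)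
    have "z \<in> path_image h \<longleftrightarrow> \<phi> z \<in> \<phi> ` (U \<inter> path_image h)"
      using inj z by (auto simp: inj_on_def)
    then show ?thesis using h z by simp
  qed
  ultimately show ?thesis
    using that[of N r \<phi> \<psi>] r(1) U(4) by blast
qed

lemma arc_stays_near:
  assumes "arc h" "0 < s" "s < 1" "open N" "h s \<in> N"
  obtains \<delta> where "0 < \<delta>" "ball s \<delta> \<subseteq> {0<..<1} \<inter> h -` N"
proof -
  have "continuous_on {0..1} h"
    using assms by (simp add: arc_def path_def)
  then have "continuous_on {0<..<1} h"
    using continuous_on_subset greaterThanLessThan_subseteq_atLeastAtMost_iff by blast
  then have "open ({0<..<1} \<inter> h -` N)"
    using assms by (simp add: continuous_open_preimage)
  moreover have "s \<in> {0<..<1} \<inter> h -` N"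
    using assms by simp
  ultimately show ?thesis
    using that openE by blast
qed

text \<open>Near \<open>s0\<close> the function \<open>f \<circ> h\<close> is continuous and
  injective, hence strictly monotone, so its zero at \<open>s0\<close> is a sign change.\<close>

lemma arc_coordinate_changes_sign:
  fixes f :: "complex \<Rightarrow> real"
  assumes "arc h" "0 < s0" "s0 < 1" "open N" "h s0 \<in> N" "continuous_on N f"
    and inj: "inj_on f (N \<inter> path_image h)" and "f (h s0) = 0"
  obtains \<delta> where "0 < \<delta>"
    "\<And>s s'. \<lbrakk>s0 - \<delta> < s; s < s0; s0 < s'; s' < s0 + \<delta>\<rbrakk> \<Longrightarrow>
       0 < s \<and> s' < 1 \<and> h s \<in> N \<and> h s' \<in> N \<and>
       (f (h s) < 0 \<and> 0 < f (h s') \<or> f (h s') < 0 \<and> 0 < f (h s))"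
proof -
  have cont: "continuous_on {0..1} h" and injh: "inj_on h {0..1}"
    using assms by (auto simp: arc_def path_def)
  obtain \<delta> where \<delta>: "0 < \<delta>" "ball s0 \<delta> \<subseteq> {0<..<1} \<inter> h -` N"
    using arc_stays_near[OF assms(1-5)] .
  have "0 < s \<and> s' < 1 \<and> h s \<in> N \<and> h s' \<in> N \<and>
       (f (h s) < 0 \<and> 0 < f (h s') \<or> f (h s') < 0 \<and> 0 < f (h s))"
    if "s0 - \<delta> < s" "s < s0" "s0 < s'" "s' < s0 + \<delta>" for s s'
  proof -
    have sub: "{s..s'} \<subseteq> {0<..<1} \<inter> h -` N"
      using \<delta>(2) that by (force simp: ball_def dist_real_def)
    have "s \<in> {s..s'}" "s' \<in> {s..s'}"
      using that by auto
    then have mem: "0 < s" "s' < 1" "h s \<in> N" "h s' \<in> N"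
      using sub by auto
    have "continuous_on {s..s'} (f \<circ> h)"
      using cont sub assms(6)
      by (intro continuous_on_compose) (auto elim!: continuous_on_subset)
    moreover have "inj_on (f \<circ> h) {s..s'}"
    proof (rule comp_inj_on)
      show "inj_on h {s..s'}"
        using injh by (rule inj_on_subset) (use sub in auto)
      show "inj_on f (h ` {s..s'})"
        using inj by (rule inj_on_subset) (use sub in \<open>auto simp: path_image_def\<close>)
    qed
    ultimately show ?thesis
      using continuous_inj_imp_mono[of s s0 s' "f \<circ> h"] that mem assms by auto
  qed
  then show ?thesis
    using that \<delta>(1) by blast
qed

section \<open>Side changes and the parity of crossings with a Jordan curve\<close>

lemma properly_cross_at_param:
  assumes "properly_cross_at p g h"
  obtains s where "0 < s" "s < 1" "h s = p"
proof -
  have "p \<in> arc_interior h"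
    using assms by (simp add: properly_cross_at_def)
  then obtain s where "s \<in> {0..1}" "h s = p" "p \<noteq> h 0" "p \<noteq> h 1"
    by (auto simp: arc_interior_def path_image_def pathstart_def pathfinish_def)
  then show ?thesis
    using that[of s] by (cases "s = 0"; cases "s = 1") auto
qed

text \<open>In a chart inside \<open>W\<close> the curve \<open>J\<close> is the real axis and
  \<open>h\<close> passes along the imaginary axis from one half-disc to the other. The choice of
  \<open>\<delta>\<close> depends on \<open>g\<close>, \<open>h\<close> and \<open>W\<close> but not
  on \<open>J\<close>; this uniformity lets one pair of points serve many curves, as
  \<open>reference_points\<close> requires.\<close>

lemma crossing_changes_side:
  assumes cr: "properly_cross_at p g h" and "arc h" "0 < s0" "s0 < 1" "h s0 = p" "open W" "p \<in> W"
  obtains \<delta> where "0 < \<delta>"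
    "\<And>s s' J. \<lbrakk>s0 - \<delta> < s; s < s0; s0 < s'; s' < s0 + \<delta>; jordan_curve J; J \<inter> W = path_image g \<inter> W\<rbrakk> \<Longrightarrow>
       0 < s \<and> s' < 1 \<and> h s \<notin> J \<and> h s' \<notin> J \<and> (h s \<in> inside J \<longleftrightarrow> h s' \<notin> inside J)"
proof -
  obtain N \<phi> \<psi> r where N: "open N" "p \<in> N" "N \<subseteq> W" "0 < r" "\<phi> p = 0"
    "continuous_on N \<phi>" "continuous_on (ball 0 r) \<psi>" "inj_on \<phi> N"
    and \<phi>N: "\<And>z. z \<in> N \<Longrightarrow> \<phi> z \<in> ball (0::complex) r \<and> \<psi> (\<phi> z) = z"
    and \<psi>B: "\<And>w. w \<in> ball 0 r \<Longrightarrow> \<psi> w \<in> N \<and> \<phi> (\<psi> w) = w"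
    and g: "\<And>z. z \<in> N \<Longrightarrow> z \<in> path_image g \<longleftrightarrow> Im (\<phi> z) = 0"
    and h: "\<And>z. z \<in> N \<Longrightarrow> z \<in> path_image h \<longleftrightarrow> Re (\<phi> z) = 0"
    by (rule properly_cross_at_chart[OF cr assms(6,7)]) (rule that)
  have "inj_on (\<lambda>z. Im (\<phi> z)) (N \<inter> path_image h)"
    using inj_onD[OF N(8)] h by (intro inj_onI) (metis IntE complex_eqI)
  moreover have "continuous_on N (\<lambda>z. Im (\<phi> z))"
    using N(6) by (intro continuous_intros)
  ultimately obtain \<delta> where \<delta>: "0 < \<delta>"
    "\<And>s s'. \<lbrakk>s0 - \<delta> < s; s < s0; s0 < s'; s' < s0 + \<delta>\<rbrakk> \<Longrightarrow>
       0 < s \<and> s' < 1 \<and> h s \<in> N \<and> h s' \<in> N \<and>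
       (Im (\<phi> (h s)) < 0 \<and> 0 < Im (\<phi> (h s')) \<or> Im (\<phi> (h s')) < 0 \<and> 0 < Im (\<phi> (h s)))"
    using arc_coordinate_changes_sign[of h s0 N "\<lambda>z. Im (\<phi> z)"] assms(2-5) N(1,2,5) by auto
  have "0 < s \<and> s' < 1 \<and> h s \<notin> J \<and> h s' \<notin> J \<and> (h s \<in> inside J \<longleftrightarrow> h s' \<notin> inside J)"
    if s: "s0 - \<delta> < s" "s < s0" "s0 < s'" "s' < s0 + \<delta>" and J: "jordan_curve J" "J \<inter> W = path_image g \<inter> W"
    for s s' J
  proof -
    define Up where "Up = \<psi> ` (ball 0 r \<inter> {z. Im z > 0})"
    define Dn where "Dn = \<psi> ` (ball 0 r \<inter> {z. Im z < 0})"
    have NJ: "z \<in> J \<longleftrightarrow> Im (\<phi> z) = 0" if "z \<in> N" for z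
      using J(2) g that N(3) by blast
    have "connected (ball 0 r \<inter> {z. Im z > 0})" "connected (ball 0 r \<inter> {z. Im z < 0})"
      by (intro convex_connected convex_Int convex_ball convex_halfspace_Im_gt convex_halfspace_Im_lt)+
    then have conn: "connected Up" "connected Dn"
      unfolding Up_def Dn_def
      by (auto intro!: connected_continuous_image intro: continuous_on_subset[OF N(7)])
    have disj: "Up \<inter> J = {}" "Dn \<inter> J = {}"
      unfolding Up_def Dn_def using NJ \<psi>B by auto
    have Up: "z \<in> Up" if "z \<in> N" "Im (\<phi> z) > 0" for z
      unfolding Up_def using \<phi>N[OF that(1)] that by (intro image_eqI[of _ _ "\<phi> z"]) auto
    have Dn: "z \<in> Dn" if "z \<in> N" "Im (\<phi> z) < 0" for z
      unfolding Dn_def using \<phi>N[OF that(1)] that by (intro image_eqI[of _ _ "\<phi> z"]) auto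
    have "p \<in> J"
      using NJ[OF N(2)] N(5) by simp
    then obtain x y where xy: "x \<in> N" "x \<in> inside J" "y \<in> N" "y \<in> outside J"
      using jordan_curve_meets_sides[OF J(1) _ N(1,2)] by blast
    have y: "y \<notin> inside J" "y \<notin> J" and "x \<notin> J"
      using xy by (auto simp: outside_def inside_def)
    have xyside: "x \<in> Up \<or> x \<in> Dn" "y \<in> Up \<or> y \<in> Dn"
      using NJ xy y \<open>x \<notin> J\<close> Up Dn by (metis linorder_neqE_linordered_idom)+
    \<comment> \<open>Each half-disc is connected and avoids \<open>J\<close>, so it lies on one
      side. As \<open>p\<close> is a frontier point of both sides, both occur in \<open>N\<close>,
      and the half-discs must lie on different ones.\<close>
    have diff: "u \<in> inside J \<longleftrightarrow> w \<notin> inside J" if "u \<in> Up" "w \<in> Dn" for u w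
      using connected_same_side[OF conn(1) disj(1)] connected_same_side[OF conn(2) disj(2)] xyside xy y that
      by metis
    show ?thesis
      using \<delta>(2)[OF s] Up Dn NJ diff by (metis less_irrefl)
  qed
  then show ?thesis
    using that \<delta>(1) by blast
qed

text \<open>Induction on the number of parameters in \<open>T\<close>: the smallest one is removed
  by moving the left end of the interval just beyond it, which flips the side once.\<close>

lemma parity_of_side_changes:
  fixes h :: "real \<Rightarrow> complex"
  assumes "finite T" "T \<subseteq> {a<..<b}" "a \<le> b" "continuous_on {a..b} h"
    and "\<And>s. s \<in> {a..b} \<Longrightarrow> h s \<in> J \<longleftrightarrow> s \<in> T"
    and "\<And>s0. s0 \<in> T \<Longrightarrow> \<exists>\<delta>>0. \<forall>s s'. s0 - \<delta> < s \<longrightarrow> s < s0 \<longrightarrow> s0 < s' \<longrightarrow> s' < s0 + \<delta> \<longrightarrow>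
        (h s \<in> inside J \<longleftrightarrow> h s' \<notin> inside J)"
  shows "(h a \<in> inside J \<longleftrightarrow> h b \<in> inside J) \<longleftrightarrow> even (card T)"
  using assms
proof (induction "card T" arbitrary: T a)
  case 0
  then have "T = {}"
    by simp
  have "connected (h ` {a..b})"
    using 0 by (intro connected_continuous_image) auto
  moreover have "h ` {a..b} \<inter> J = {}"
    using 0 \<open>T = {}\<close> by auto
  ultimately have "h a \<in> inside J \<longleftrightarrow> h b \<in> inside J"
    using 0 by (intro connected_same_side) auto
  then show ?case
    using \<open>T = {}\<close> by simp
next
  case (Suc n)
  define s0 where "s0 = Min T"
  define T' where "T' = T - {s0}"
  have s0: "s0 \<in> T" "\<And>s. s \<in> T \<Longrightarrow> s0 \<le> s"
    using Suc.hyps(2) Suc.prems(1) unfolding s0_def by (auto intro!: Min_in)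
  then have ab: "a < s0" "s0 < b"
    using Suc.prems by auto
  obtain \<delta> where \<delta>: "\<delta> > 0" "\<And>s s'. \<lbrakk>s0 - \<delta> < s; s < s0; s0 < s'; s' < s0 + \<delta>\<rbrakk> \<Longrightarrow>
        (h s \<in> inside J \<longleftrightarrow> h s' \<notin> inside J)"
    using Suc.prems(6)[OF s0(1)] by blast
  \<comment> \<open>The next parameter in \<open>T\<close> after \<open>s0\<close>, or
    \<open>b\<close> if there is none; the new left end \<open>c\<close> is chosen strictly between
    \<open>s0\<close> and \<open>m\<close>.\<close>
  define m where "m = Min (insert b T')"
  have fin: "finite T'" using Suc.prems by (simp add: T'_def)
  have m: "s0 < m" "m \<le> b" "\<And>s. s \<in> T' \<Longrightarrow> m \<le> s"
  proof -
    have "m \<in> insert b T'"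
      unfolding m_def using fin by (intro Min_in) auto
    then show "s0 < m"
      using ab s0 by (auto simp: T'_def less_le)
  qed (use fin in \<open>auto simp: m_def\<close>)
  obtain c where c: "s0 < c" "c < m" "c < s0 + \<delta>"
    using dense[of s0 "min m (s0 + \<delta>)"] m \<delta> by auto
  obtain d where d: "a < d" "s0 - \<delta> < d" "d < s0"
    using dense[of "max a (s0 - \<delta>)" s0] ab \<delta> by auto
  have cb: "c \<le> b" using c m by simp
  have "connected (h ` {a..d})"
    using ab d Suc.prems(4) by (intro connected_continuous_image) (auto elim!: continuous_on_subset)
  moreover have "h ` {a..d} \<inter> J = {}"
    using Suc.prems(5) s0 d ab by fastforce
  ultimately have "h a \<in> inside J \<longleftrightarrow> h d \<in> inside J"
    using d by (intro connected_same_side) auto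
  also have "\<dots> \<longleftrightarrow> h c \<notin> inside J"
    using \<delta>(2)[of d c] c d by auto
  finally have 1: "h a \<in> inside J \<longleftrightarrow> h c \<notin> inside J" .
  have "(h c \<in> inside J \<longleftrightarrow> h b \<in> inside J) \<longleftrightarrow> even (card T')"
  proof (rule Suc.hyps(1))
    show "n = card T'"
      using Suc.hyps(2) Suc.prems(1) s0 by (simp add: T'_def)
    show "T' \<subseteq> {c<..<b}"
      using m(3) c Suc.prems(2) by (force simp: T'_def)
    show "continuous_on {c..b} h"
      using Suc.prems(4) by (rule continuous_on_subset) (use c ab in auto)
    show "h s \<in> J \<longleftrightarrow> s \<in> T'" if "s \<in> {c..b}" for s
      using Suc.prems(5)[of s] that c ab by (auto simp: T'_def)
    show "\<exists>\<delta>>0. \<forall>s s'. s1 - \<delta> < s \<longrightarrow> s < s1 \<longrightarrow> s1 < s' \<longrightarrow> s' < s1 + \<delta> \<longrightarrow>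
        (h s \<in> inside J \<longleftrightarrow> h s' \<notin> inside J)" if "s1 \<in> T'" for s1
      using Suc.prems(6)[of s1] that by (simp add: T'_def)
  qed (use fin cb in auto)
  moreover have "card T = Suc (card T')"
    using Suc.prems(1) s0 unfolding T'_def by (metis card.remove)
  ultimately show ?case
    using 1 by auto
qed

text \<open>The condition on \<open>J\<close> is local: around each common point it has to coincide
  with some arc that \<open>h\<close> crosses properly. This suits curves glued from several edges
  and halves of edges.\<close>

lemma crossing_parity:
  assumes J: "jordan_curve J" and h: "arc h" and "pathstart h \<notin> J" "pathfinish h \<notin> J"
    and fin: "finite (J \<inter> path_image h)"
    and cr: "\<And>p. p \<in> J \<inter> path_image h \<Longrightarrow>
      \<exists>g W. properly_cross_at p g h \<and> open W \<and> p \<in> W \<and> J \<inter> W = path_image g \<inter> W"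
  shows "(pathstart h \<in> inside J \<longleftrightarrow> pathfinish h \<in> inside J) \<longleftrightarrow> even (card (J \<inter> path_image h))"
proof -
  define T where "T = {s \<in> {0..1}. h s \<in> J}"
  have inj: "inj_on h {0..1}" and cont: "continuous_on {0..1} h"
    using h by (auto simp: arc_def path_def)
  have T: "h ` T = J \<inter> path_image h"
    by (auto simp: T_def path_image_def)
  have injT: "inj_on h T"
    using inj by (rule inj_on_subset) (auto simp: T_def)
  have "finite T"
    using fin T injT by (metis finite_imageD)
  have "card T = card (J \<inter> path_image h)"
    using T injT by (metis card_image)
  moreover have "(h 0 \<in> inside J \<longleftrightarrow> h 1 \<in> inside J) \<longleftrightarrow> even (card T)"
  proof (rule parity_of_side_changes)
    have "0 \<notin> T" "1 \<notin> T"
      using assms by (auto simp: T_def pathstart_def pathfinish_def)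
    then show sub: "T \<subseteq> {0<..<1}"
      by (auto simp: T_def less_le)
    show "\<exists>\<delta>>0. \<forall>s s'. s0 - \<delta> < s \<longrightarrow> s < s0 \<longrightarrow> s0 < s' \<longrightarrow> s' < s0 + \<delta> \<longrightarrow>
        (h s \<in> inside J \<longleftrightarrow> h s' \<notin> inside J)" if s0: "s0 \<in> T" for s0
    proof -
      obtain g W where gW: "properly_cross_at (h s0) g h" "open W" "h s0 \<in> W" "J \<inter> W = path_image g \<inter> W"
        using cr[of "h s0"] s0 T by blast
      have "0 < s0" "s0 < 1"
        using sub s0 by auto
      from crossing_changes_side[OF gW(1) h this refl gW(2,3)] obtain \<delta> where "0 < \<delta>"
        "\<And>s s' J. \<lbrakk>s0 - \<delta> < s; s < s0; s0 < s'; s' < s0 + \<delta>; jordan_curve J; J \<inter> W = path_image g \<inter> W\<rbrakk> \<Longrightarrow>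
          0 < s \<and> s' < 1 \<and> h s \<notin> J \<and> h s' \<notin> J \<and> (h s \<in> inside J \<longleftrightarrow> h s' \<notin> inside J)"
        by blast
      then show ?thesis
        using gW(4) J by blast
    qed
  qed (use \<open>finite T\<close> cont in \<open>auto simp: T_def\<close>)
  ultimately show ?thesis
    by (simp add: pathstart_def pathfinish_def)
qed

text \<open>Near \<open>p\<close> the set \<open>J\<close> is contained in the parts of
  \<open>g\<close> and \<open>h\<close> that lead up to \<open>p\<close>. The parts after
  \<open>p\<close> follow two perpendicular half-axes of the chart, and the open quadrant between
  these is free of \<open>J\<close>, so they can be joined there.\<close>

lemma crossing_corner:
  assumes cr: "properly_cross_at p g h" and g: "arc g" "0 < t0" "t0 < 1" "g t0 = p"
    and h: "arc h" "0 < s0" "s0 < 1" "h s0 = p"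
    and W: "open W" "p \<in> W" "J \<inter> W \<subseteq> g ` {0..t0} \<union> h ` {0..s0}"
  shows "\<exists>x \<in> g ` {t0..1} - {p}. \<exists>y \<in> h ` {s0..1} - {p}. x \<in> inside J \<longleftrightarrow> y \<in> inside J"
proof -
  obtain N \<phi> \<psi> r where N: "open N" "p \<in> N" "N \<subseteq> W" "0 < r" "\<phi> p = 0"
    "continuous_on N \<phi>" "continuous_on (ball 0 r) \<psi>" "inj_on \<phi> N"
    and \<phi>N: "\<And>z. z \<in> N \<Longrightarrow> \<phi> z \<in> ball (0::complex) r \<and> \<psi> (\<phi> z) = z"
    and \<psi>B: "\<And>w. w \<in> ball 0 r \<Longrightarrow> \<psi> w \<in> N \<and> \<phi> (\<psi> w) = w"
    and gN: "\<And>z. z \<in> N \<Longrightarrow> z \<in> path_image g \<longleftrightarrow> Im (\<phi> z) = 0"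
    and hN: "\<And>z. z \<in> N \<Longrightarrow> z \<in> path_image h \<longleftrightarrow> Re (\<phi> z) = 0"
    by (rule properly_cross_at_chart[OF cr W(1,2)]) (rule that)
  have near: "\<exists>t. t1 < t \<and> t < 1 \<and> k t \<in> N" if k: "arc k" "0 < t1" "t1 < 1" "k t1 = p" for k t1
  proof -
    obtain e where e: "0 < e" "ball t1 e \<subseteq> {0<..<1} \<inter> k -` N"
      using arc_stays_near[OF k(1-3) N(1)] k(4) N(2) by blast
    then have "t1 + e / 2 \<in> {0<..<1} \<inter> k -` N"
      by (intro subsetD[OF e(2)]) (auto simp: dist_real_def)
    then show ?thesis
      using e(1) by (intro exI[of _ "t1 + e / 2"]) auto
  qed
  obtain t s where t: "t0 < t" "t < 1" "g t \<in> N" and s: "s0 < s" "s < 1" "h s \<in> N"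
    using near[OF g] near[OF h] by blast
  have injg: "inj_on g {0..1}" and injh: "inj_on h {0..1}"
    using g h by (auto simp: arc_def)
  have ne: "g t \<noteq> p" "h s \<noteq> p"
    using inj_onD[OF injg, of t t0] inj_onD[OF injh, of s s0] t s g h by auto
  define \<alpha> \<beta> where "\<alpha> = \<phi> (g t)" and "\<beta> = \<phi> (h s)"
  have axes: "Im \<alpha> = 0" "Re \<beta> = 0"
    using gN[OF t(3)] hN[OF s(3)] t s g h by (auto simp: \<alpha>_def \<beta>_def path_image_def)
  have "\<alpha> \<noteq> 0" "\<beta> \<noteq> 0"
    using inj_onD[OF N(8), of "g t" p] inj_onD[OF N(8), of "h s" p] t s ne N by (auto simp: \<alpha>_def \<beta>_def)
  then have nz: "Re \<alpha> \<noteq> 0" "Im \<beta> \<noteq> 0"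
    using axes by (auto simp: complex_eq_iff)
  \<comment> \<open>in the chart, the segment from \<open>\<alpha>\<close> to \<open>\<beta>\<close> meets the two axes only in its endpoints\<close>
  have seg: "closed_segment \<alpha> \<beta> \<subseteq> ball 0 r"
    using \<phi>N[OF t(3)] \<phi>N[OF s(3)] by (intro closed_segment_subset) (auto simp: \<alpha>_def \<beta>_def)
  have conn: "connected (\<psi> ` closed_segment \<alpha> \<beta>)"
    using continuous_on_subset[OF N(7) seg] by (intro connected_continuous_image) auto
  have disj: "\<psi> ` closed_segment \<alpha> \<beta> \<inter> J = {}"
  proof (intro equals0I)
    fix z assume "z \<in> \<psi> ` closed_segment \<alpha> \<beta> \<inter> J"
    then obtain w where w: "w \<in> closed_segment \<alpha> \<beta>" "z = \<psi> w" "z \<in> J"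
      by blast
    then obtain u where u: "w = (1 - u) *\<^sub>R \<alpha> + u *\<^sub>R \<beta>"
      by (auto simp: closed_segment_def)
    have z: "z \<in> N" "\<phi> z = w"
      using \<psi>B[of w] w seg by auto
    then consider "z \<in> g ` {0..t0}" | "z \<in> h ` {0..s0}"
      using W(3) w(3) N(3) by blast
    then show False
    proof cases
      case 1
      then have "z \<in> path_image g"
        using g by (auto simp: path_image_def)
      then have "u = 0"
        using gN[OF z(1)] z(2) u axes nz by simp
      then have "z = g t"
        using u w \<phi>N[OF t(3)] by (simp add: \<alpha>_def)
      then obtain x where "g t = g x" "0 \<le> x" "x \<le> t0"
        using 1 by auto
      then show False
        using inj_onD[OF injg, of t x] t g(2,3) by simp
    next
      case 2
      then have "z \<in> path_image h"
        using h by (auto simp: path_image_def)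
      then have "u = 1"
        using hN[OF z(1)] z(2) u axes nz by simp
      then have "z = h s"
        using u w \<phi>N[OF s(3)] by (simp add: \<beta>_def)
      then obtain x where "h s = h x" "0 \<le> x" "x \<le> s0"
        using 2 by auto
      then show False
        using inj_onD[OF injh, of s x] s h(2,3) by simp
    qed
  qed
  have "g t \<in> \<psi> ` closed_segment \<alpha> \<beta>" "h s \<in> \<psi> ` closed_segment \<alpha> \<beta>"
    using \<phi>N[OF t(3)] \<phi>N[OF s(3)] by (force simp: \<alpha>_def \<beta>_def)+
  then have "g t \<in> inside J \<longleftrightarrow> h s \<in> inside J"
    using connected_same_side[OF conn disj] by blast
  then show ?thesis
    using t s ne by (intro bexI[of _ "g t"] bexI[of _ "h s"]) auto
qed

section \<open>Crossings in complete simple topological graphs\<close>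

locale complete_simple_topological_graph =
  simple_topological_graph V "complete_edges V" \<gamma>
  for V :: "complex set" and \<gamma> :: "complex set \<Rightarrow> real \<Rightarrow> complex"
begin

definition edge_path :: "complex \<Rightarrow> complex \<Rightarrow> real \<Rightarrow> complex" where
  "edge_path x y = (if pathstart (\<gamma> {x, y}) = x then \<gamma> {x, y} else reversepath (\<gamma> {x, y}))"

definition edge :: "complex \<Rightarrow> complex \<Rightarrow> complex set" where
  "edge x y = path_image (\<gamma> {x, y})"

text \<open>For four distinct vertices this says that the edges cross: a common point cannot be a
  vertex, so the edges cross properly there, and it is their only common point.\<close>

definition meets :: "complex \<Rightarrow> complex \<Rightarrow> complex \<Rightarrow> complex \<Rightarrow> bool" where
  "meets a b c d \<longleftrightarrow> edge a b \<inter> edge c d \<noteq> {}"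

definition triangle :: "complex \<Rightarrow> complex \<Rightarrow> complex \<Rightarrow> complex set" where
  "triangle x y z = edge x y \<union> edge y z \<union> edge z x"

lemma edge_commute: "edge x y = edge y x"
  by (simp add: edge_def insert_commute)

lemma meets_commute:
  "meets a b c d \<longleftrightarrow> meets c d a b" "meets a b c d \<longleftrightarrow> meets b a c d" "meets a b c d \<longleftrightarrow> meets a b d c"
  by (auto simp: meets_def edge_commute[of a b] edge_commute[of c d])

lemma triangle_swap: "triangle x y z = triangle y x z"
  by (auto simp: triangle_def edge_commute)

lemma mem_complete_edges: "x \<in> V \<Longrightarrow> y \<in> V \<Longrightarrow> x \<noteq> y \<Longrightarrow> {x, y} \<in> complete_edges V"
  by (simp add: complete_edges_def)

lemma edge_path:
  assumes "x \<in> V" "y \<in> V" "x \<noteq> y"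
  shows "arc (edge_path x y)" "path_image (edge_path x y) = edge x y"
    "pathstart (edge_path x y) = x" "pathfinish (edge_path x y) = y"
proof -
  have e: "{x, y} \<in> complete_edges V"
    using assms by (rule mem_complete_edges)
  show "arc (edge_path x y)" "path_image (edge_path x y) = edge x y"
    using arc_edge[OF e] by (auto simp: edge_path_def edge_def arc_reversepath)
  have "{pathstart (\<gamma> {x, y}), pathfinish (\<gamma> {x, y})} = {x, y}"
    by (rule endpoints_edge[OF e])
  then show "pathstart (edge_path x y) = x" "pathfinish (edge_path x y) = y"
    by (auto simp: edge_path_def doubleton_eq_iff)
qed

lemma edge_arc_between:
  assumes "x \<in> V" "y \<in> V" "x \<noteq> y"
  shows "arc_between (edge x y) x y"
  unfolding arc_between_def using edge_path[OF assms] by blast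

lemma edge_endpoints:
  assumes "x \<in> V" "y \<in> V" "x \<noteq> y"
  shows "x \<in> edge x y" "y \<in> edge x y"
  using arc_between_endpoints[OF edge_arc_between[OF assms]] by auto

lemma edge_closed: "x \<in> V \<Longrightarrow> y \<in> V \<Longrightarrow> x \<noteq> y \<Longrightarrow> closed (edge x y)"
  using arc_between_closed edge_arc_between by blast

lemma vertex_notin_edge: "\<lbrakk>x \<in> V; y \<in> V; x \<noteq> y; z \<in> V; z \<noteq> x; z \<noteq> y\<rbrakk> \<Longrightarrow> z \<notin> edge x y"
  using vertices_on_edge[OF mem_complete_edges] by (auto simp: edge_def)

lemma edge_inter_unique:
  assumes "{a, b, c, d} \<subseteq> V" "a \<noteq> b" "c \<noteq> d" "{a, b} \<noteq> {c, d}"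
    "p \<in> edge a b" "p \<in> edge c d" "q \<in> edge a b" "q \<in> edge c d"
  shows "p = q"
  using intersect_at_most_once[OF mem_complete_edges mem_complete_edges, of a b c d p q] assms
  by (auto simp: edge_def)

lemma edge_inter_adjacent:
  assumes "{x, y, z} \<subseteq> V" "distinct [x, y, z]"
  shows "edge x y \<inter> edge y z = {y}"
proof -
  have "y \<in> edge x y" "y \<in> edge y z"
    using assms edge_endpoints by auto
  moreover have "p = y" if "p \<in> edge x y" "p \<in> edge y z" for p
    using assms that calculation by (intro edge_inter_unique[of x y y z]) (auto simp: doubleton_eq_iff)
  ultimately show ?thesis
    by blast
qed

lemma edge_inter_singleton:
  assumes "{a, b, c, d} \<subseteq> V" "distinct [a, b, c, d]" "q \<in> edge a b" "q \<in> edge c d"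
  shows "edge a b \<inter> edge c d = {q}"
proof -
  have "{a, b} \<noteq> {c, d}"
    using assms by (auto simp: doubleton_eq_iff)
  then have "p = q" if "p \<in> edge a b" "p \<in> edge c d" for p
    using edge_inter_unique[of a b c d p q] assms that by simp
  then show ?thesis
    using assms by blast
qed

lemma edge_cross_at:
  assumes "{a, b, c, d} \<subseteq> V" "distinct [a, b, c, d]" "p \<in> edge a b" "p \<in> edge c d"
  shows "properly_cross_at p (edge_path a b) (edge_path c d)"
proof -
  have "properly_cross_at p (\<gamma> {a, b}) (\<gamma> {c, d})"
    using intersection_cases[OF mem_complete_edges mem_complete_edges, of a b c d p] assms
    by (auto simp: edge_def doubleton_eq_iff)
  then show ?thesis
    by (simp add: edge_path_def properly_cross_at_reversepath)
qed

lemma card_edge_inter: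
  assumes "{a, b, c, d} \<subseteq> V" "distinct [a, b, c, d]"
  shows "finite (edge a b \<inter> edge c d)" "card (edge a b \<inter> edge c d) = of_bool (meets a b c d)"
proof -
  have "edge a b \<inter> edge c d = {} \<or> (\<exists>p. edge a b \<inter> edge c d = {p})"
    using edge_inter_singleton[OF assms] by blast
  then show "finite (edge a b \<inter> edge c d)" "card (edge a b \<inter> edge c d) = of_bool (meets a b c d)"
    by (auto simp: meets_def)
qed

section \<open>Edges against Jordan curves, triangles and complete graphs on four vertices\<close>

lemma edge_parity:
  assumes J: "jordan_curve J" and xy: "x \<in> V" "y \<in> V" "x \<noteq> y" "x \<notin> J" "y \<notin> J"
    and fin: "finite (J \<inter> edge x y)"
    and cr: "\<And>p. p \<in> J \<inter> edge x y \<Longrightarrow> \<exists>a b W. {a, b} \<subseteq> V \<and> distinct [a, b, x, y] \<and> p \<in> edge a b \<and>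
      open W \<and> p \<in> W \<and> J \<inter> W = edge a b \<inter> W"
  shows "(x \<in> inside J \<longleftrightarrow> y \<in> inside J) \<longleftrightarrow> even (card (J \<inter> edge x y))"
proof -
  note ep = edge_path[OF xy(1-3)]
  have "\<exists>g W. properly_cross_at p g (edge_path x y) \<and> open W \<and> p \<in> W \<and> J \<inter> W = path_image g \<inter> W"
    if p: "p \<in> J \<inter> edge x y" for p
  proof -
    obtain a b W where *: "{a, b} \<subseteq> V" "distinct [a, b, x, y]" "p \<in> edge a b" "open W" "p \<in> W"
      "J \<inter> W = edge a b \<inter> W"
      using cr[OF p] by blast
    then show ?thesis
      using edge_cross_at[of a b x y p] edge_path[of a b] xy p
      by (intro exI[of _ "edge_path a b"] exI[of _ W]) auto
  qed
  then show ?thesis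
    using crossing_parity[OF J ep(1)] ep xy fin by simp
qed

text \<open>Away from the closed set \<open>K\<close> the curve \<open>J\<close> is just the edge
  \<open>a b\<close>, so \<open>x y\<close> meets \<open>J\<close> exactly once. This is meant for
  curves that contain halves of edges, where \<open>triangle_parity\<close> does not apply.\<close>

lemma single_crossing_separates:
  assumes J: "jordan_curve J" "J = edge a b \<union> K" "closed K" "K \<inter> edge x y = {}"
    and V: "{a, b, x, y} \<subseteq> V" "distinct [a, b, x, y]" and "meets a b x y"
  shows "x \<in> inside J \<longleftrightarrow> y \<notin> inside J"
proof -
  have "x \<notin> J" "y \<notin> J"
    using vertex_notin_edge[of a b] edge_endpoints[of x y] V J by auto
  have eq: "J \<inter> edge x y = edge a b \<inter> edge x y"
    using J by blast
  have "(x \<in> inside J \<longleftrightarrow> y \<in> inside J) \<longleftrightarrow> even (card (J \<inter> edge x y))"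
  proof (rule edge_parity[OF J(1)])
    fix p assume "p \<in> J \<inter> edge x y"
    then show "\<exists>a b W. {a, b} \<subseteq> V \<and> distinct [a, b, x, y] \<and> p \<in> edge a b \<and>
      open W \<and> p \<in> W \<and> J \<inter> W = edge a b \<inter> W"
      using J V by (intro exI[of _ a] exI[of _ b] exI[of _ "- K"]) auto
  qed (use V \<open>x \<notin> J\<close> \<open>y \<notin> J\<close> eq card_edge_inter in auto)
  then show ?thesis
    using eq card_edge_inter[OF V] assms by simp
qed

lemma triangle_jordan:
  assumes "{x, y, z} \<subseteq> V" "distinct [x, y, z]"
  shows "jordan_curve (triangle x y z)"
  unfolding triangle_def
  using assms edge_inter_adjacent[of x y z] edge_inter_adjacent[of y z x] edge_inter_adjacent[of z x y]
  by (intro jordan_curve_triangle[of _ x y _ z] edge_arc_between) auto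

lemma vertex_notin_triangle:
  assumes "{x, y, z, w} \<subseteq> V" "distinct [x, y, z, w]"
  shows "w \<notin> triangle x y z"
  using assms vertex_notin_edge by (auto simp: triangle_def)

text \<open>The right-hand side is the propositional form of: \<open>u w\<close> crosses an even
  number of the three edges of the triangle.\<close>

lemma triangle_parity:
  assumes V: "{x, y, z, u, w} \<subseteq> V" "distinct [x, y, z, u, w]"
  shows "(u \<in> inside (triangle x y z) \<longleftrightarrow> w \<in> inside (triangle x y z)) \<longleftrightarrow>
    (meets u w x y \<longleftrightarrow> (meets u w y z \<longleftrightarrow> \<not> meets u w z x))"
proof -
  let ?T = "triangle x y z"
  have adj: "edge x y \<inter> edge y z = {y}" "edge y z \<inter> edge z x = {z}" "edge z x \<inter> edge x y = {x}"
    using V by (auto intro!: edge_inter_adjacent)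
  have nv: "x \<notin> edge u w" "y \<notin> edge u w" "z \<notin> edge u w"
    using V vertex_notin_edge by auto
  have eq: "?T \<inter> edge u w = (edge x y \<inter> edge u w) \<union> (edge y z \<inter> edge u w) \<union> (edge z x \<inter> edge u w)"
    by (auto simp: triangle_def)
  have cl: "closed (edge x y)" "closed (edge y z)" "closed (edge z x)"
    using V by (auto intro!: edge_closed)
  have fin: "finite (edge x y \<inter> edge u w)" "finite (edge y z \<inter> edge u w)" "finite (edge z x \<inter> edge u w)"
    and card: "card (edge x y \<inter> edge u w) = of_bool (meets x y u w)"
    "card (edge y z \<inter> edge u w) = of_bool (meets y z u w)"
    "card (edge z x \<inter> edge u w) = of_bool (meets z x u w)"
    using V card_edge_inter[of x y u w] card_edge_inter[of y z u w] card_edge_inter[of z x u w]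
    by (simp_all add: eq_commute[of z x])
  have "card (?T \<inter> edge u w) = card (edge x y \<inter> edge u w) + card (edge y z \<inter> edge u w) + card (edge z x \<inter> edge u w)"
    unfolding eq using fin adj nv by (subst card_Un_disjoint, force, force, force)+ simp
  then have "card (?T \<inter> edge u w) = of_bool (meets u w x y) + of_bool (meets u w y z) + of_bool (meets u w z x)"
    using card meets_commute(1) by simp
  moreover have "(u \<in> inside ?T \<longleftrightarrow> w \<in> inside ?T) \<longleftrightarrow> even (card (?T \<inter> edge u w))"
  proof (rule edge_parity)
    show "jordan_curve ?T"
      using V by (intro triangle_jordan) auto
    show "u \<notin> ?T" "w \<notin> ?T"
      using V vertex_notin_triangle[of x y z u] vertex_notin_triangle[of x y z w] by auto
    show "finite (?T \<inter> edge u w)"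
      using eq fin by simp
    show "\<exists>a b W. {a, b} \<subseteq> V \<and> distinct [a, b, u, w] \<and> p \<in> edge a b \<and> open W \<and> p \<in> W \<and> ?T \<inter> W = edge a b \<inter> W"
      if pT: "p \<in> ?T \<inter> edge u w" for p
    proof -
      have p: "p \<in> edge u w" using pT by simp
      \<comment> \<open>Two edges of the triangle share only a vertex, which is not on
        \<open>u w\<close>. So \<open>p\<close> lies on exactly one of the three, and the complement
        of the other two is the required neighbourhood.\<close>
      consider "p \<in> edge x y" | "p \<in> edge y z" | "p \<in> edge z x"
        using pT by (auto simp: triangle_def)
      then show ?thesis
      proof cases
        case 1
        moreover have "p \<notin> edge y z" "p \<notin> edge z x"
          using 1 adj nv p by (auto simp: set_eq_iff)
        ultimately show ?thesis
          using V cl by (intro exI[of _ x] exI[of _ y] exI[of _ "- (edge y z \<union> edge z x)"])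
            (auto simp: triangle_def)
      next
        case 2
        moreover have "p \<notin> edge x y" "p \<notin> edge z x"
          using 2 adj nv p by (auto simp: set_eq_iff)
        ultimately show ?thesis
          using V cl by (intro exI[of _ y] exI[of _ z] exI[of _ "- (edge x y \<union> edge z x)"])
            (auto simp: triangle_def)
      next
        case 3
        moreover have "p \<notin> edge y z" "p \<notin> edge x y"
          using 3 adj nv p by (auto simp: set_eq_iff)
        ultimately show ?thesis
          using V cl by (intro exI[of _ z] exI[of _ x] exI[of _ "- (edge y z \<union> edge x y)"])
            (auto simp: triangle_def)
      qed
    qed
  qed (use V in auto)
  ultimately show ?thesis
    by (auto simp: of_bool_def split: if_splits)
qed

text \<open>The edge \<open>b d\<close> is adjacent to both \<open>a b\<close> and
  \<open>c d\<close>, so it meets them only in its own ends. If \<open>p\<close> is the crossing of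
  \<open>a b\<close> and \<open>c d\<close>, then \<open>b d\<close> can meet the closed curve
  through \<open>a\<close>, \<open>c\<close> and \<open>p\<close> only on \<open>a c\<close>, and
  there at most once.\<close>

lemma K4_at_most_one_crossing:
  assumes V: "{a, b, c, d} \<subseteq> V" "distinct [a, b, c, d]" and "meets a b c d"
  shows "\<not> meets a c b d"
proof
  assume "meets a c b d"
  obtain p where p: "p \<in> edge a b" "p \<in> edge c d"
    using assms by (auto simp: meets_def)
  define g h where "g = edge_path a b" and "h = edge_path c d"
  have g: "arc g" "path_image g = edge a b" "pathstart g = a" "pathfinish g = b"
    and h: "arc h" "path_image h = edge c d" "pathstart h = c" "pathfinish h = d"
    using V edge_path[of a b] edge_path[of c d] by (auto simp: g_def h_def)
  have cr: "properly_cross_at p g h"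
    unfolding g_def h_def using V p by (rule edge_cross_at)
  obtain t where t: "0 < t" "t < 1" "g t = p"
    using properly_cross_at_param[OF properly_cross_at_sym[OF cr]] .
  obtain s where s: "0 < s" "s < 1" "h s = p"
    using properly_cross_at_param[OF cr] .
  define G1 G2 H1 H2 where "G1 = g ` {0..t}" and "G2 = g ` {t..1}" and "H1 = h ` {0..s}" and "H2 = h ` {s..1}"
  have G: "arc_between G1 a p" "arc_between G2 p b" "G1 \<union> G2 = edge a b" "G1 \<inter> G2 = {p}"
    using arc_between_split_param[OF g(1) t(1,2)] g t by (auto simp: G1_def G2_def)
  have H: "arc_between H1 c p" "arc_between H2 p d" "H1 \<union> H2 = edge c d" "H1 \<inter> H2 = {p}"
    using arc_between_split_param[OF h(1) s(1,2)] h s by (auto simp: H1_def H2_def)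
  have ep: "a \<in> G1" "p \<in> G1" "b \<in> G2" "p \<in> G2" "c \<in> H1" "p \<in> H1" "d \<in> H2" "p \<in> H2"
    "p \<noteq> a" "p \<noteq> b" "p \<noteq> c" "p \<noteq> d"
    using arc_between_endpoints[OF G(1)] arc_between_endpoints[OF G(2)]
      arc_between_endpoints[OF H(1)] arc_between_endpoints[OF H(2)] by auto
  have ends: "b \<notin> G1" "a \<notin> G2" "d \<notin> H1" "c \<notin> H2"
    using G(4) H(4) ep by (metis IntI singletonD)+
  have GH: "edge a b \<inter> edge c d = {p}"
    using V p by (rule edge_inter_singleton)
  have adj: "edge a c \<inter> edge c d = {c}" "edge a c \<inter> edge a b = {a}" "edge b d \<inter> edge c d = {d}"
    "edge b d \<inter> edge a b = {b}"
    using V edge_inter_adjacent[of a c d] edge_inter_adjacent[of c a b] edge_inter_adjacent[of b d c]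
      edge_inter_adjacent[of d b a] edge_commute[of a c] edge_commute[of c d] edge_commute[of b d] edge_commute[of a b]
    by auto
  \<comment> \<open>\<open>b d\<close> crosses \<open>J\<close> exactly once, but \<open>b\<close> and \<open>d\<close> can also be joined around the corner \<open>p\<close> of \<open>J\<close>\<close>
  define J where "J = edge a c \<union> H1 \<union> G1"
  have J: "jordan_curve J"
    unfolding J_def
  proof (rule jordan_curve_triangle[of _ a c _ p])
    show "arc_between (edge a c) a c"
      using V by (intro edge_arc_between) auto
    show "arc_between H1 c p" "arc_between G1 p a"
      using G H arc_between_sym by auto
    show "edge a c \<inter> H1 = {c}" "G1 \<inter> edge a c = {a}"
      using adj G(3) H(3) ep by blast+
    show "H1 \<inter> G1 = {p}"
      using GH G(3) H(3) ep by blast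
  qed
  have "b \<in> inside J \<longleftrightarrow> d \<notin> inside J"
  proof (rule single_crossing_separates[OF J])
    show "J = edge a c \<union> (H1 \<union> G1)"
      by (auto simp: J_def)
    show "closed (H1 \<union> G1)"
      using G H arc_between_closed by blast
    show "(H1 \<union> G1) \<inter> edge b d = {}"
      using adj ends G(3) H(3) by (auto simp: set_eq_iff)
  qed (use V \<open>meets a c b d\<close> in auto)
  moreover have "b \<in> inside J \<longleftrightarrow> d \<in> inside J"
  proof -
    have "p \<notin> edge a c"
      using adj ep p by blast
    then have "\<exists>x \<in> G2 - {p}. \<exists>y \<in> H2 - {p}. x \<in> inside J \<longleftrightarrow> y \<in> inside J"
      using V edge_closed[of a c] unfolding G2_def H2_def
      by (intro crossing_corner[OF cr g(1) t h(1) s, of "- edge a c"]) (auto simp: J_def G1_def H1_def)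
    then obtain x y where xy: "x \<in> G2 - {p}" "y \<in> H2 - {p}" "x \<in> inside J \<longleftrightarrow> y \<in> inside J"
      by blast
    have av: "(G2 - {p}) \<inter> J = {}" "(H2 - {p}) \<inter> J = {}"
      using adj ends GH G(3,4) H(3,4) unfolding J_def by (auto simp: set_eq_iff)
    have "b \<in> G2 - {p}" "d \<in> H2 - {p}"
      using ep by auto
    then have "x \<in> inside J \<longleftrightarrow> b \<in> inside J" "y \<in> inside J \<longleftrightarrow> d \<in> inside J"
      using connected_same_side[OF arc_between_connected(2)[OF G(2)] av(1) xy(1)]
        connected_same_side[OF arc_between_connected(2)[OF H(2)] av(2) xy(2)] by blast+
    then show ?thesis
      using xy by blast
  qed
  ultimately show False
    by blast
qed

section \<open>Sides of the triangles over a fixed edge \<open>v a\<close>\<close>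

text \<open>The edge \<open>x y\<close> meets the triangle \<open>v a x\<close> only in
  \<open>x\<close> and \<open>q\<close>. It changes sides at \<open>q\<close> and nowhere else, so
  its open half before \<open>q\<close> lies opposite to \<open>y\<close>.\<close>

lemma half_edge_side:
  assumes V: "{x, y, v, a} \<subseteq> V" "distinct [x, y, v, a]" and q: "q \<in> edge x y" "q \<in> edge v a"
  obtains E where "arc_between E x q" "E \<subseteq> edge x y"
    "\<And>z. z \<in> E - {x, q} \<Longrightarrow> z \<notin> triangle v a x \<and>
       (z \<in> inside (triangle v a x) \<longleftrightarrow> y \<notin> inside (triangle v a x))"
proof -
  let ?T = "triangle v a x"
  define h where "h = edge_path x y"
  have h: "arc h" "path_image h = edge x y" "pathstart h = x" "pathfinish h = y"
    using V edge_path[of x y] by (auto simp: h_def)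
  have cr: "properly_cross_at q (edge_path v a) h"
    unfolding h_def using V q by (intro edge_cross_at) auto
  obtain s where s: "0 < s" "s < 1" "h s = q"
    using properly_cross_at_param[OF cr] .
  define E F where "E = h ` {0..s}" and "F = h ` {s..1}"
  have EF: "arc_between E x q" "arc_between F q y" "E \<union> F = edge x y" "E \<inter> F = {q}"
    using arc_between_split_param[OF h(1) s(1,2)] h s by (auto simp: E_def F_def)
  have adj: "edge x y \<inter> edge x v = {x}" "edge x y \<inter> edge a x = {x}"
    "edge v a \<inter> edge a x = {a}" "edge v a \<inter> edge x v = {v}"
    using V edge_inter_adjacent[of y x v] edge_inter_adjacent[of a x y] edge_inter_adjacent[of v a x]
      edge_inter_adjacent[of x v a] edge_commute[of x y] by auto
  have nv: "v \<notin> edge x y" "a \<notin> edge x y" "x \<notin> edge v a" "y \<notin> edge v a"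
    using V vertex_notin_edge by auto
  have "edge x y \<inter> edge v a = {q}"
    using V q by (rule edge_inter_singleton)
  then have meet: "edge x y \<inter> ?T = {x, q}"
    using adj q by (auto simp: triangle_def)
  have ends: "x \<in> E" "q \<in> E" "q \<in> F" "y \<in> F" "x \<noteq> q" "y \<noteq> q"
    using arc_between_endpoints[OF EF(1)] arc_between_endpoints[OF EF(2)] by auto
  have notin: "x \<notin> F" "y \<notin> E"
    using EF(4) ends by (metis IntI singletonD)+
  have avoid: "(E - {x, q}) \<inter> ?T = {}" "(F - {q}) \<inter> ?T = {}"
    using meet EF(3) notin by (auto simp: set_eq_iff)
  let ?W = "- (edge a x \<union> edge x v)"
  have qn: "q \<notin> edge a x" "q \<notin> edge x v"
    using q adj nv by (auto simp: set_eq_iff)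
  have W: "open ?W" "q \<in> ?W" "?T \<inter> ?W = path_image (edge_path v a) \<inter> ?W"
    using V edge_closed qn edge_path[of v a] by (auto simp: triangle_def)
  obtain \<delta> where \<delta>: "0 < \<delta>"
    "\<And>r r' J. \<lbrakk>s - \<delta> < r; r < s; s < r'; r' < s + \<delta>; jordan_curve J;
        J \<inter> ?W = path_image (edge_path v a) \<inter> ?W\<rbrakk> \<Longrightarrow>
       0 < r \<and> r' < 1 \<and> h r \<notin> J \<and> h r' \<notin> J \<and> (h r \<in> inside J \<longleftrightarrow> h r' \<notin> inside J)"
    using crossing_changes_side[OF cr h(1) s W(1,2)] by blast
  have T: "jordan_curve ?T"
    using V by (intro triangle_jordan) auto
  have *: "0 < s - \<delta> / 2" "s + \<delta> / 2 < 1" "h (s - \<delta> / 2) \<notin> ?T" "h (s + \<delta> / 2) \<notin> ?T"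
    "h (s - \<delta> / 2) \<in> inside ?T \<longleftrightarrow> h (s + \<delta> / 2) \<notin> inside ?T"
    using \<delta>(2)[of "s - \<delta> / 2" "s + \<delta> / 2", OF _ _ _ _ T W(3)] \<delta>(1) by auto
  have "x \<in> ?T" "q \<in> ?T"
    using meet by auto
  then have mem: "h (s - \<delta> / 2) \<in> E - {x, q}" "h (s + \<delta> / 2) \<in> F - {q}"
    using * \<delta>(1) unfolding E_def F_def by auto
  have "z \<notin> ?T \<and> (z \<in> inside ?T \<longleftrightarrow> y \<notin> inside ?T)" if "z \<in> E - {x, q}" for z
    using connected_same_side[OF arc_between_connected(4)[OF EF(1)] avoid(1) that mem(1)]
      connected_same_side[OF arc_between_connected(2)[OF EF(2)] avoid(2) _ mem(2), of y]
      that avoid(1) ends *(5) by blast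
  then show ?thesis
    using that EF(1,3) by blast
qed

text \<open>The points lie on \<open>k l\<close>, just before and just after its crossing
  \<open>q\<close> with \<open>v a\<close>. They serve all \<open>m\<close> simultaneously:
  \<open>W\<close> is a neighbourhood of \<open>q\<close> that avoids every other edge at
  \<open>v\<close> or \<open>a\<close>, so inside \<open>W\<close> each triangle
  \<open>v a m\<close> is just the edge \<open>v a\<close>.\<close>

lemma reference_points:
  assumes V: "{v, a, k, l} \<subseteq> V" "distinct [v, a, k, l]" and "meets k l v a"
  obtains u w where "\<And>m. m \<in> V - {v, a} \<Longrightarrow> u \<notin> triangle v a m \<and> w \<notin> triangle v a m \<and>
    (u \<in> inside (triangle v a m) \<longleftrightarrow> w \<notin> inside (triangle v a m))"
proof -
  obtain q where q: "q \<in> edge k l" "q \<in> edge v a"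
    using assms by (auto simp: meets_def)
  define h where "h = edge_path k l"
  have h: "arc h"
    using V edge_path[of k l] by (auto simp: h_def)
  have cr: "properly_cross_at q (edge_path v a) h"
    unfolding h_def using V q by (intro edge_cross_at) auto
  obtain s where s: "0 < s" "s < 1" "h s = q"
    using properly_cross_at_param[OF cr] .
  define W where "W = - (\<Union>m \<in> V - {v, a}. edge a m \<union> edge m v)"
  have "closed (\<Union>m \<in> V - {v, a}. edge a m \<union> edge m v)"
    using V finite_vertices by (intro closed_UN ballI closed_Un edge_closed) auto
  then have "open W"
    unfolding W_def by (rule open_Compl)
  have nv: "v \<notin> edge k l" "a \<notin> edge k l"
    using V vertex_notin_edge by auto
  have "q \<notin> edge a m \<union> edge m v" if "m \<in> V - {v, a}" for m
    using that V q nv edge_inter_adjacent[of v a m] edge_inter_adjacent[of m v a] by auto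
  then have "q \<in> W"
    by (simp add: W_def)
  obtain \<delta> where \<delta>: "0 < \<delta>"
    "\<And>r r' J. \<lbrakk>s - \<delta> < r; r < s; s < r'; r' < s + \<delta>; jordan_curve J;
        J \<inter> W = path_image (edge_path v a) \<inter> W\<rbrakk> \<Longrightarrow>
       0 < r \<and> r' < 1 \<and> h r \<notin> J \<and> h r' \<notin> J \<and> (h r \<in> inside J \<longleftrightarrow> h r' \<notin> inside J)"
    using crossing_changes_side[OF cr h s \<open>open W\<close> \<open>q \<in> W\<close>] by blast
  show ?thesis
  proof (rule that[of "h (s - \<delta> / 2)" "h (s + \<delta> / 2)"])
    fix m assume m: "m \<in> V - {v, a}"
    have "jordan_curve (triangle v a m)"
      using V m by (intro triangle_jordan) auto
    moreover have "triangle v a m \<inter> W = path_image (edge_path v a) \<inter> W"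
      using m V edge_path[of v a] by (auto simp: triangle_def W_def)
    ultimately show "h (s - \<delta> / 2) \<notin> triangle v a m \<and> h (s + \<delta> / 2) \<notin> triangle v a m \<and>
      (h (s - \<delta> / 2) \<in> inside (triangle v a m) \<longleftrightarrow> h (s + \<delta> / 2) \<notin> inside (triangle v a m))"
      using \<delta>(2)[of "s - \<delta> / 2" "s + \<delta> / 2" "triangle v a m"] \<delta>(1) by auto
  qed
qed

text \<open>The legs \<open>v l\<close> and \<open>a l\<close> touch the triangle
  \<open>v a k\<close> only in \<open>v\<close> and \<open>a\<close>, so they run on the side of
  \<open>l\<close>. Hence the side of \<open>v a k\<close> that contains \<open>w\<close> misses the
  triangle \<open>v a l\<close>; being connected, it lies on a single side of it, and
  \<open>k\<close> is one of its boundary points.\<close>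

lemma nested_sides:
  assumes V: "{v, a, k, l} \<subseteq> V" "distinct [v, a, k, l]" and "meets k l v a"
    and w: "w \<notin> triangle v a k" "w \<notin> triangle v a l"
    and l: "l \<in> inside (triangle v a k) \<longleftrightarrow> w \<notin> inside (triangle v a k)"
  shows "\<And>x. \<lbrakk>x \<notin> triangle v a k; x \<in> inside (triangle v a k) \<longleftrightarrow> w \<in> inside (triangle v a k)\<rbrakk> \<Longrightarrow>
      x \<in> inside (triangle v a l) \<longleftrightarrow> w \<in> inside (triangle v a l)"
    and "k \<in> inside (triangle v a l) \<longleftrightarrow> w \<in> inside (triangle v a l)"
proof -
  let ?K = "triangle v a k" and ?L = "triangle v a l"
  have jK: "jordan_curve ?K" and jL: "jordan_curve ?L"
    using V by (auto intro!: triangle_jordan)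
  \<comment> \<open>In the \<open>K4\<close> on \<open>v\<close>, \<open>a\<close>,
    \<open>k\<close>, \<open>l\<close> the one possible crossing is already used by
    \<open>k l\<close> and \<open>v a\<close>.\<close>
  have "\<not> meets k v l a" "\<not> meets k a l v"
    using K4_at_most_one_crossing[of k l v a] K4_at_most_one_crossing[of k l a v] V \<open>meets k l v a\<close>
      meets_commute(3)[of k l v a] by auto
  then have disj: "edge k v \<inter> edge a l = {}" "edge a k \<inter> edge v l = {}"
    by (auto simp: meets_def edge_commute)
  have adj: "edge v l \<inter> edge v a = {v}" "edge v l \<inter> edge k v = {v}" "edge a l \<inter> edge v a = {a}" "edge a l \<inter> edge a k = {a}"
    using V edge_inter_adjacent[of l v a] edge_inter_adjacent[of l v k] edge_inter_adjacent[of l a v]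
      edge_inter_adjacent[of l a k] by (auto simp: edge_commute)
  define D where "D = (edge v l - {v}) \<union> (edge a l - {a})"
  have "l \<in> edge v l" "l \<in> edge a l"
    using V edge_endpoints by auto
  have "connected D"
    unfolding D_def
  proof (rule connected_Un)
    show "connected (edge v l - {v})" "connected (edge a l - {a})"
      using V by (auto intro!: arc_between_connected(2)[OF edge_arc_between])
    show "(edge v l - {v}) \<inter> (edge a l - {a}) \<noteq> {}"
      using V \<open>l \<in> edge v l\<close> \<open>l \<in> edge a l\<close> by auto
  qed
  have "D \<inter> ?K = {}"
    using adj disj unfolding D_def triangle_def by blast
  have "l \<in> D"
    using V \<open>l \<in> edge v l\<close> by (auto simp: D_def)
  have D: "z \<in> inside ?K \<longleftrightarrow> w \<notin> inside ?K" if "z \<in> D" for z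
    using connected_same_side[OF \<open>connected D\<close> \<open>D \<inter> ?K = {}\<close> \<open>l \<in> D\<close> that] l by blast
  define R where "R = (if w \<in> inside ?K then inside ?K else outside ?K)"
  have R: "x \<in> R \<longleftrightarrow> x \<notin> ?K \<and> (x \<in> inside ?K \<longleftrightarrow> w \<in> inside ?K)" for x
    by (auto simp: R_def inside_def outside_def)
  have cR: "connected R"
    using jordan_curve_sides[OF jK] by (simp add: R_def)
  have "R \<inter> ?L = {}"
  proof -
    have "?L \<subseteq> ?K \<union> D"
      using adj by (auto simp: triangle_def D_def edge_commute[of l v])
    then show ?thesis
      using R D by blast
  qed
  have "w \<in> R"
    using R w by blast
  show *: "x \<in> inside ?L \<longleftrightarrow> w \<in> inside ?L" if "x \<notin> ?K" "x \<in> inside ?K \<longleftrightarrow> w \<in> inside ?K" for x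
    using connected_same_side[OF cR \<open>R \<inter> ?L = {}\<close> _ \<open>w \<in> R\<close>, of x] R that by blast
  \<comment> \<open>\<open>Q\<close> is an open neighbourhood of \<open>k\<close> on one side of
    \<open>v a l\<close>. Since \<open>k\<close> is a frontier point of \<open>R\<close>, the two
    sets intersect, and this transfers the side of \<open>R\<close> to \<open>k\<close>.\<close>
  define Q where "Q = (if k \<in> inside ?L then inside ?L else outside ?L)"
  have "k \<notin> ?L"
    using V by (intro vertex_notin_triangle) auto
  then have "k \<in> Q"
    by (auto simp: Q_def inside_def outside_def)
  have "k \<in> ?K"
    using V edge_endpoints by (auto simp: triangle_def)
  have "open Q"
    using jordan_curve_sides[OF jL] by (simp add: Q_def)
  then have "Q \<inter> R \<noteq> {}"
    using jordan_curve_meets_sides[OF jK \<open>k \<in> ?K\<close> _ \<open>k \<in> Q\<close>] by (auto simp: R_def)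
  then obtain x where x: "x \<in> Q" "x \<in> R"
    by blast
  have "x \<in> inside ?L \<longleftrightarrow> k \<in> inside ?L"
    using x(1) by (auto simp: Q_def inside_def outside_def split: if_splits)
  then show "k \<in> inside ?L \<longleftrightarrow> w \<in> inside ?L"
    using * x(2) R by blast
qed

subsection \<open>Edges crossing a fixed edge\<close>

lemma K4_exclusive:
  assumes "{v, k, l, m} \<subseteq> V" "distinct [v, k, l, m]"
  shows "\<not> (meets k l v m \<and> meets l m v k)" "\<not> (meets k l v m \<and> meets k m v l)"
    "\<not> (meets l m v k \<and> meets k m v l)"
proof -
  show "\<not> (meets k l v m \<and> meets l m v k)"
    using K4_at_most_one_crossing[of l k m v] assms
      meets_commute(2)[of l k m v] meets_commute(3)[of k l m v] meets_commute(3)[of l m k v] by auto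
  show "\<not> (meets k l v m \<and> meets k m v l)"
    using K4_at_most_one_crossing[of k l m v] assms
      meets_commute(3)[of k l m v] meets_commute(3)[of k m l v] by auto
  show "\<not> (meets l m v k \<and> meets k m v l)"
    using K4_at_most_one_crossing[of m l k v] assms
      meets_commute(2)[of m l k v] meets_commute(3)[of l m k v]
      meets_commute(2)[of m k l v] meets_commute(3)[of k m l v] by auto
qed

lemma crossing_edges_legs_disjoint:
  assumes "{v, a, k, l} \<subseteq> V" "distinct [v, a, k, l]" "meets k l v a"
  shows "\<not> meets a k v l" "\<not> meets a l v k"
proof -
  show "\<not> meets a k v l"
    using K4_at_most_one_crossing[of k l a v] assms
      meets_commute(3)[of k l v a] meets_commute(2)[of k a l v] meets_commute(3)[of a k l v] by auto
  show "\<not> meets a l v k"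
    using K4_at_most_one_crossing[of l k a v] assms meets_commute(2)[of k l v a]
      meets_commute(3)[of l k v a] meets_commute(2)[of l a k v] meets_commute(3)[of a l k v] by auto
qed

text \<open>
  Points \<open>u\<close> and \<open>w\<close> close to an interior point of the edge \<open>v a\<close>, one on each side of it, form such a
  pair; they name the two sides of all triangles \<open>v a m\<close> consistently, which replaces the rotation of
  the edges around \<open>v\<close>.
\<close>

definition reference_pair :: "complex \<Rightarrow> complex \<Rightarrow> complex \<Rightarrow> complex \<Rightarrow> bool" where
  "reference_pair v a u w \<longleftrightarrow> (\<forall>m \<in> V - {v, a}. u \<notin> triangle v a m \<and> w \<notin> triangle v a m \<and>
    (u \<in> inside (triangle v a m) \<longleftrightarrow> w \<notin> inside (triangle v a m)))"

text \<open>Read: as seen from \<open>u\<close>, the vertex \<open>l\<close> lies beyond the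
  triangle \<open>v a k\<close>. By \<open>below_nested\<close> the side of \<open>u\<close> then
  grows in passing from \<open>v a k\<close> to \<open>v a l\<close>, so this is an order by
  inclusion of sides.\<close>

definition below :: "complex \<Rightarrow> complex \<Rightarrow> complex \<Rightarrow> complex \<Rightarrow> complex \<Rightarrow> bool" where
  "below v a u k l \<longleftrightarrow> k \<noteq> l \<and> meets k l v a \<and>
    (l \<in> inside (triangle v a k) \<longleftrightarrow> u \<notin> inside (triangle v a k))"

lemma reference_pair_swap: "reference_pair v a u w \<Longrightarrow> reference_pair a v u w"
  by (simp add: reference_pair_def triangle_swap[of v a] insert_commute)

lemma below_swap: "below v a u k l = below a v u k l"
  by (simp add: below_def triangle_swap[of v a] meets_commute(3)[of k l v a])

text \<open>If \<open>k\<close> is on the side of \<open>u\<close> with respect to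
  \<open>v a l\<close>, then it is on the side opposite to \<open>w\<close>. So
  \<open>nested_sides\<close> applies with \<open>w\<close> as the reference point and puts
  \<open>l\<close> on the side of \<open>w\<close> with respect to \<open>v a k\<close>.\<close>

lemma below_total:
  assumes V: "{v, a, k, l} \<subseteq> V" "distinct [v, a, k, l]" and "reference_pair v a u w" "meets k l v a"
  shows "below v a u k l \<or> below v a u l k"
proof (rule disjCI)
  assume "\<not> below v a u l k"
  then have "k \<in> inside (triangle v a l) \<longleftrightarrow> w \<notin> inside (triangle v a l)"
    using assms meets_commute(2)[of k l] by (auto simp: below_def reference_pair_def)
  then have "l \<in> inside (triangle v a k) \<longleftrightarrow> w \<in> inside (triangle v a k)"
    using nested_sides(2)[of v a l k w] assms meets_commute(2)[of k l] by (auto simp: reference_pair_def)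
  then show "below v a u k l"
    using assms by (auto simp: below_def reference_pair_def)
qed

lemma below_sides:
  assumes V: "{v, a, k, l} \<subseteq> V" "distinct [v, a, k, l]" and "reference_pair v a u w" "below v a u k l"
  shows "meets k l v a"
    and "l \<in> inside (triangle v a k) \<longleftrightarrow> u \<notin> inside (triangle v a k)"
    and "k \<in> inside (triangle v a l) \<longleftrightarrow> u \<in> inside (triangle v a l)"
proof -
  show b: "meets k l v a" "l \<in> inside (triangle v a k) \<longleftrightarrow> u \<notin> inside (triangle v a k)"
    using assms by (auto simp: below_def)
  have "u \<notin> triangle v a k" "u \<notin> triangle v a l"
    using assms by (auto simp: reference_pair_def)
  then show "k \<in> inside (triangle v a l) \<longleftrightarrow> u \<in> inside (triangle v a l)"
    using nested_sides(2)[OF V b(1) _ _ b(2)] by blast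
qed

lemma below_nested:
  assumes V: "{v, a, k, l} \<subseteq> V" "distinct [v, a, k, l]" and "reference_pair v a u w" "below v a u k l"
    and "x \<notin> triangle v a k" "x \<in> inside (triangle v a k) \<longleftrightarrow> u \<in> inside (triangle v a k)"
  shows "x \<in> inside (triangle v a l) \<longleftrightarrow> u \<in> inside (triangle v a l)"
proof -
  have "u \<notin> triangle v a k" "u \<notin> triangle v a l"
    using assms by (auto simp: reference_pair_def)
  then show ?thesis
    using nested_sides(1)[OF V _ _ _ _ assms(5,6)] assms(4) by (auto simp: below_def)
qed

lemma leg_parity:
  assumes "{v, a, k, l, m} \<subseteq> V" "distinct [v, a, k, l, m]"
  shows "(k \<in> inside (triangle v a m) \<longleftrightarrow> l \<in> inside (triangle v a m)) \<longleftrightarrow>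
    (meets k l v a \<longleftrightarrow> (meets k l a m \<longleftrightarrow> \<not> meets k l v m))"
  using triangle_parity[of v a m k l] assms meets_commute(3)[of k l m v] by auto

text \<open>Nesting settles the side conditions; the point is that \<open>k m\<close> crosses
  \<open>v a\<close>. If it did not, parity would make each of \<open>k l\<close>,
  \<open>l m\<close>, \<open>k m\<close> cross exactly one of the two edges from \<open>v\<close>
  and \<open>a\<close> to the remaining vertex.\<close>

lemma below_trans:
  assumes V: "{v, a, k, l, m} \<subseteq> V" "v \<noteq> a" "{k, l, m} \<inter> {v, a} = {}" and ref: "reference_pair v a u w"
    and kl: "below v a u k l" and lm: "below v a u l m"
  shows "below v a u k m"
proof -
  have "k \<noteq> l" "l \<noteq> m"
    using kl lm by (auto simp: below_def)
  have sl: "k \<in> inside (triangle v a l) \<longleftrightarrow> u \<in> inside (triangle v a l)"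
    "m \<in> inside (triangle v a l) \<longleftrightarrow> u \<notin> inside (triangle v a l)"
    using below_sides(3)[OF _ _ ref kl] below_sides(2)[OF _ _ ref lm] V \<open>k \<noteq> l\<close> \<open>l \<noteq> m\<close> by auto
  then have "k \<noteq> m"
    by blast
  have D: "{v, a, k, l, m} \<subseteq> V" "distinct [v, a, k, l, m]"
    using V \<open>k \<noteq> l\<close> \<open>l \<noteq> m\<close> \<open>k \<noteq> m\<close> by auto
  have "m \<notin> triangle v a k" "k \<notin> triangle v a l"
    using D vertex_notin_triangle[of v a k m] vertex_notin_triangle[of v a l k] by auto
  then have sk: "m \<in> inside (triangle v a k) \<longleftrightarrow> u \<notin> inside (triangle v a k)"
    and sm: "k \<in> inside (triangle v a m) \<longleftrightarrow> u \<in> inside (triangle v a m)"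
    using below_nested[OF _ _ ref kl, of m] below_nested[OF _ _ ref lm, of k] sl D by auto
  have k: "l \<in> inside (triangle v a k) \<longleftrightarrow> u \<notin> inside (triangle v a k)" "meets k l v a"
    and m: "l \<in> inside (triangle v a m) \<longleftrightarrow> u \<in> inside (triangle v a m)" "meets l m v a"
    using below_sides[OF _ _ ref kl] below_sides[OF _ _ ref lm] D by auto
  have "meets k l a m \<longleftrightarrow> \<not> meets k l v m"
    using leg_parity[of v a k l m] k m sm D by auto
  moreover have "meets l m a k \<longleftrightarrow> \<not> meets l m v k"
    using leg_parity[of v a l m k] k m sk D by auto
  moreover have "meets k m a l \<longleftrightarrow> \<not> meets k m v l" if "\<not> meets k m v a"
    using leg_parity[of v a k m l] sl D that by auto
  ultimately have "meets k m v a"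
    \<comment> \<open>otherwise two of the three crossings lie in one \<open>K\<^sub>4\<close>, spanned by \<open>k l m\<close> and \<open>v\<close> or \<open>a\<close>\<close>
    using K4_exclusive[of v k l m] K4_exclusive[of a k l m] D by auto
  then show ?thesis
    using sk \<open>k \<noteq> m\<close> by (simp add: below_def)
qed

text \<open>All three edges cross \<open>v a\<close>, so by parity \<open>k l\<close> and
  \<open>l m\<close> each cross exactly one leg of the remaining vertex, while \<open>k m\<close>
  crosses both legs of \<open>l\<close> or neither. Both is impossible: \<open>l m\<close> crosses a
  leg of \<open>k\<close>, and this would be a second crossing in the \<open>K4\<close> on
  \<open>k\<close>, \<open>l\<close>, \<open>m\<close> and \<open>v\<close> or
  \<open>a\<close>.\<close>

lemma chain_crossings:
  assumes V: "{v, a, k, l, m} \<subseteq> V" "distinct [v, a, k, l, m]" and ref: "reference_pair v a u w"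
    and kl: "below v a u k l" and lm: "below v a u l m" and km: "below v a u k m"
  shows "meets k l v m \<longleftrightarrow> \<not> meets k l a m" "meets l m v k \<longleftrightarrow> \<not> meets l m a k"
    "\<not> meets k m v l" "\<not> meets k m a l"
proof -
  have *: "meets k l v a" "meets l m v a" "meets k m v a"
    and k: "l \<in> inside (triangle v a k) \<longleftrightarrow> m \<in> inside (triangle v a k)"
    and l: "k \<in> inside (triangle v a l) \<longleftrightarrow> m \<notin> inside (triangle v a l)"
    and m: "k \<in> inside (triangle v a m) \<longleftrightarrow> l \<in> inside (triangle v a m)"
    using below_sides[OF _ _ ref kl] below_sides[OF _ _ ref lm] below_sides[OF _ _ ref km] V by simp_all
  show "meets k l v m \<longleftrightarrow> \<not> meets k l a m"
    using leg_parity[of v a k l m] * m V by auto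
  show 2: "meets l m v k \<longleftrightarrow> \<not> meets l m a k"
    using leg_parity[of v a l m k] * k V by auto
  have "meets k m v l \<longleftrightarrow> meets k m a l"
    using leg_parity[of v a k m l] * l V by auto
  then show "\<not> meets k m v l" "\<not> meets k m a l"
    using 2 K4_exclusive(3)[of v k l m] K4_exclusive(3)[of a k l m] V by auto
qed

section \<open>Interlaced edges of a chain\<close>

text \<open>The closed curve consists of \<open>v x\<close>, the part \<open>E\<close> of
  \<open>x y\<close> from \<open>x\<close> to \<open>q\<close>, and \<open>A\<close>. The edge
  \<open>m n\<close> could meet it only on \<open>v x\<close>, which would separate \<open>m\<close>
  from \<open>n\<close>. But \<open>a m\<close> and \<open>a n\<close> avoid it: they cannot cross
  \<open>v x\<close> because \<open>x m\<close> and \<open>x n\<close> cross \<open>v a\<close>,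
  they meet \<open>v a\<close> only in \<open>a\<close>, and \<open>E\<close> runs on the other side
  of \<open>v a x\<close>.\<close>

lemma half_curve_not_crossed:
  assumes V: "{x, y, v, a, m, n} \<subseteq> V" "distinct [x, y, v, a, m, n]"
    and q: "q \<in> edge x y" and A: "arc_between A v q" "A \<subseteq> edge v a" "a \<notin> A" "A \<inter> edge m n = {}"
    and xymn: "edge x y \<inter> edge m n = {}"
    and legs: "meets x m v a" "meets x n v a"
    and sides: "m \<in> inside (triangle v a x) \<longleftrightarrow> y \<in> inside (triangle v a x)"
      "n \<in> inside (triangle v a x) \<longleftrightarrow> y \<in> inside (triangle v a x)"
  shows "\<not> meets m n v x"
proof
  assume cr: "meets m n v x"
  have qva: "q \<in> edge v a"
    using arc_between_endpoints[OF A(1)] A(2) by blast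
  obtain E where E: "arc_between E x q" "E \<subseteq> edge x y"
    and Eside: "\<And>z. z \<in> E - {x, q} \<Longrightarrow> z \<notin> triangle v a x \<and>
       (z \<in> inside (triangle v a x) \<longleftrightarrow> y \<notin> inside (triangle v a x))"
    using half_edge_side[of x y v a q] V q qva by (auto intro: that)
  \<comment> \<open>Without \<open>a\<close>, the edge \<open>a k\<close> is connected and avoids
    the triangle \<open>v a x\<close>, so it stays on the side of \<open>k\<close> and
    \<open>y\<close>, whereas the interior of \<open>E\<close> is on the opposite side.\<close>
  have E_leg: "E \<inter> edge a k = {}"
    if k: "k \<in> V" "distinct [x, y, v, a, k]" "meets x k v a"
      "k \<in> inside (triangle v a x) \<longleftrightarrow> y \<in> inside (triangle v a x)" for k
  proof -
    have "edge a k \<inter> edge x v = {}"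
      using crossing_edges_legs_disjoint(2)[of v a x k] k V by (auto simp: meets_def edge_commute)
    moreover have "edge a k \<inter> edge v a = {a}" "edge a k \<inter> edge a x = {a}"
      using edge_inter_adjacent[of k a v] edge_inter_adjacent[of k a x] k V by (auto simp: edge_commute)
    ultimately have av: "(edge a k - {a}) \<inter> triangle v a x = {}"
      by (auto simp: triangle_def set_eq_iff)
    have conn: "connected (edge a k - {a})"
      using k V by (intro arc_between_connected(2)[OF edge_arc_between]) auto
    have "k \<in> edge a k - {a}"
      using k V edge_endpoints by auto
    from connected_same_side[OF conn av _ this] k(4)
    have "z \<in> inside (triangle v a x) \<longleftrightarrow> y \<in> inside (triangle v a x)" if "z \<in> edge a k - {a}" for z
      using that by blast
    then have "z \<in> {x, q, a}" if "z \<in> E \<inter> edge a k" for z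
      using Eside that by blast
    moreover have "x \<notin> edge a k" "a \<notin> edge x y"
      using k V vertex_notin_edge by auto
    moreover have "q \<notin> edge a k"
      using q qva \<open>edge a k \<inter> edge v a = {a}\<close> \<open>a \<notin> edge x y\<close> by (auto simp: set_eq_iff)
    ultimately show ?thesis
      using E(2) by blast
  qed
  have Em: "E \<inter> edge a m = {}" and En: "E \<inter> edge a n = {}"
    using E_leg[of m] E_leg[of n] V legs sides by auto
  \<comment> \<open>the path \<open>m a n\<close> avoids \<open>J\<close>, whereas \<open>m n\<close> would cross it exactly once\<close>
  define J where "J = edge v x \<union> E \<union> A"
  have adj: "edge v x \<inter> edge x y = {x}" "edge v x \<inter> edge v a = {v}"
    using V edge_inter_adjacent[of v x y] edge_inter_adjacent[of x v a] by (auto simp: edge_commute)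
  have "edge x y \<inter> edge v a = {q}"
    using V q qva by (intro edge_inter_singleton) auto
  have ends: "x \<in> E" "q \<in> E" "q \<in> A" "v \<in> A"
    using arc_between_endpoints[OF E(1)] arc_between_endpoints[OF A(1)] by auto
  have J: "jordan_curve J"
    unfolding J_def
  proof (rule jordan_curve_triangle[of _ v x _ q])
    show "arc_between (edge v x) v x"
      using V by (intro edge_arc_between) auto
    show "arc_between E x q" "arc_between A q v"
      using E A arc_between_sym by auto
    show "edge v x \<inter> E = {x}" "A \<inter> edge v x = {v}"
      using adj E(2) A(2) ends by (auto simp: set_eq_iff)
    show "E \<inter> A = {q}"
      using \<open>edge x y \<inter> edge v a = {q}\<close> E(2) A(2) ends by (auto simp: set_eq_iff)
  qed
  have "m \<in> inside J \<longleftrightarrow> n \<notin> inside J"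
  proof (rule single_crossing_separates[OF J])
    show "J = edge v x \<union> (E \<union> A)"
      by (auto simp: J_def)
    show "closed (E \<union> A)"
      using E A arc_between_closed by blast
    show "(E \<union> A) \<inter> edge m n = {}"
      using E(2) A(4) xymn by blast
  qed (use V cr meets_commute(1)[of m n v x] in auto)
  moreover have "m \<in> inside J \<longleftrightarrow> n \<in> inside J"
  proof (rule connected_same_side)
    have ma: "m \<in> edge a m" "n \<in> edge a n" "a \<in> edge a m" "a \<in> edge a n"
      using V edge_endpoints by auto
    show "connected (edge a m \<union> edge a n)"
      using V ma by (intro connected_Un arc_between_connected(1)[OF edge_arc_between]) auto
    show "m \<in> edge a m \<union> edge a n" "n \<in> edge a m \<union> edge a n"
      using ma by auto
    have "edge a m \<inter> edge v x = {}" "edge a n \<inter> edge v x = {}"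
      using crossing_edges_legs_disjoint(2)[of v a x m] crossing_edges_legs_disjoint(2)[of v a x n] legs V
      by (auto simp: meets_def)
    moreover have "edge a m \<inter> edge v a = {a}" "edge a n \<inter> edge v a = {a}"
      using edge_inter_adjacent[of m a v] edge_inter_adjacent[of n a v] V by (auto simp: edge_commute)
    ultimately show "(edge a m \<union> edge a n) \<inter> J = {}"
      using Em En A(2,3) unfolding J_def by (auto simp: set_eq_iff)
  qed
  ultimately show False
    by blast
qed

text \<open>
  The assumption on \<open>q34\<close> says that along \<open>v a\<close> the edge \<open>w3 w4\<close> crosses closer to \<open>a\<close> than
  \<open>w1 w2\<close> does; it is no restriction, since the roles of \<open>v\<close> and \<open>a\<close> may be exchanged.
\<close>

lemma interlaced_chain_edges_disjoint_aux:
  assumes V: "{v, a, w1, w2, w3, w4} \<subseteq> V" "distinct [v, a, w1, w2, w3, w4]"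
    and ref: "reference_pair v a u w"
    and b: "below v a u w1 w2" "below v a u w1 w3" "below v a u w1 w4"
      "below v a u w2 w3" "below v a u w2 w4" "below v a u w3 w4"
    and q: "q12 \<in> edge w1 w2" "q34 \<in> edge w3 w4"
    and A: "arc_between A1 v q12" "arc_between A2 q12 a" "A1 \<union> A2 = edge v a" "A1 \<inter> A2 = {q12}" "q34 \<in> A2"
  shows "\<not> meets w1 w3 w2 w4"
proof
  assume cr: "meets w1 w3 w2 w4"
  have "\<not> meets w1 w2 w3 w4"
    using K4_at_most_one_crossing[of w1 w2 w3 w4] cr V by auto
  then have disj: "edge w1 w2 \<inter> edge w3 w4 = {}"
    by (simp add: meets_def)
  then have "q34 \<noteq> q12"
    using q by blast
  have nv: "v \<notin> edge w1 w2" "a \<notin> edge w1 w2" "v \<notin> edge w3 w4" "a \<notin> edge w3 w4"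
    using V vertex_notin_edge by auto
  then have ne: "q12 \<noteq> v" "q12 \<noteq> a" "q34 \<noteq> v" "q34 \<noteq> a"
    using q by auto
  have ends: "v \<in> A1" "q12 \<in> A1" "q12 \<in> A2" "a \<in> A2"
    using arc_between_endpoints[OF A(1)] arc_between_endpoints[OF A(2)] by auto
  have qva: "q12 \<in> edge v a" "q34 \<in> edge v a"
    using ends A by auto
  have q12: "edge w1 w2 \<inter> edge v a = {q12}" and q34: "edge w3 w4 \<inter> edge v a = {q34}"
    using V q qva edge_inter_singleton[of w1 w2 v a q12] edge_inter_singleton[of w3 w4 v a q34] by auto
  obtain B C where BC: "arc_between B q12 q34" "arc_between C q34 a" "B \<union> C = A2" "B \<inter> C = {q34}"
    using arc_between_split[OF A(2,5)] \<open>q34 \<noteq> q12\<close> ne by metis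
  have "q12 \<in> B"
    using arc_between_endpoints[OF BC(1)] by simp
  then have C: "q12 \<notin> C" "v \<notin> C"
    using BC(3,4) A(4) ends(1) \<open>q34 \<noteq> q12\<close> ne by (metis IntI UnI2 singletonD)+
  have A1: "a \<notin> A1" "q34 \<notin> A1"
    using A(4,5) ends(4) \<open>q34 \<noteq> q12\<close> ne by (metis IntI singletonD)+
  have mt: "meets w1 w2 v a" "meets w1 w3 v a" "meets w1 w4 v a" "meets w2 w3 v a" "meets w2 w4 v a" "meets w3 w4 v a"
    using b by (auto simp: below_def)
  have s1: "w3 \<in> inside (triangle v a w1) \<longleftrightarrow> w2 \<in> inside (triangle v a w1)"
    "w4 \<in> inside (triangle v a w1) \<longleftrightarrow> w2 \<in> inside (triangle v a w1)"
    using b by (auto simp: below_def)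
  have s4: "w2 \<in> inside (triangle a v w4) \<longleftrightarrow> w3 \<in> inside (triangle a v w4)"
    "w1 \<in> inside (triangle a v w4) \<longleftrightarrow> w3 \<in> inside (triangle a v w4)"
    using below_sides(3)[OF _ _ ref b(3)] below_sides(3)[OF _ _ ref b(5)] below_sides(3)[OF _ _ ref b(6)] V
    by (simp_all add: triangle_swap[of a v])
  \<comment> \<open>The curve uses the part of \<open>v a\<close> from \<open>v\<close> to
    \<open>q12\<close>; \<open>w3 w4\<close> meets \<open>v a\<close> only in \<open>q34\<close>,
    which lies beyond.\<close>
  have "\<not> meets w3 w4 v w1"
  proof (rule half_curve_not_crossed[of w1 w2 v a w3 w4 q12 A1])
    show "A1 \<inter> edge w3 w4 = {}"
    proof (intro equals0I)
      fix z assume z: "z \<in> A1 \<inter> edge w3 w4"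
      then have "z \<in> edge w3 w4 \<inter> edge v a"
        using A(3) by auto
      then show False
        using q34 A1(2) z by auto
    qed
  qed (use V q A A1 disj mt s1 in auto)
  \<comment> \<open>The mirror image: \<open>v\<close> and \<open>a\<close> are exchanged, the chain
    is reversed, and \<open>C\<close> is the part of \<open>v a\<close> between \<open>a\<close> and
    \<open>q34\<close>.\<close>
  moreover have "\<not> meets w2 w1 a w4"
  proof (rule half_curve_not_crossed[of w4 w3 a v w2 w1 q34 C])
    show "C \<inter> edge w2 w1 = {}"
    proof (intro equals0I)
      fix z assume z: "z \<in> C \<inter> edge w2 w1"
      then have "z \<in> edge w1 w2 \<inter> edge v a"
        using A(3) BC(3) edge_commute[of w1 w2] by auto
      then show False
        using q12 C(1) z by auto
    qed
    show "edge w4 w3 \<inter> edge w2 w1 = {}"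
      using disj by (auto simp: edge_commute)
    show "C \<subseteq> edge a v"
      using A(3) BC(3) by (auto simp: edge_commute)
    show "meets w4 w2 a v" "meets w4 w1 a v"
      using mt meets_commute(2)[of w4 w2 a v] meets_commute(3)[of w2 w4 a v]
        meets_commute(2)[of w4 w1 a v] meets_commute(3)[of w1 w4 a v] by auto
    show "q34 \<in> edge w4 w3" "arc_between C a q34"
      using q BC arc_between_sym by (auto simp: edge_commute)
  qed (use V C s4 in auto)
  \<comment> \<open>In a chain these edges must cross one of the two legs; the leg at the other end
    of \<open>v a\<close> is the one left.\<close>
  ultimately have "meets w3 w4 a w1" "meets w1 w2 v w4"
    using chain_crossings[of v a w1 w2 w4 u w] chain_crossings[of v a w1 w3 w4 u w] V ref b
      meets_commute(2)[of w2 w1 a w4] by auto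
  then have "\<not> meets w1 w3 a w4" "\<not> meets w2 w4 v w1"
    using K4_exclusive[of a w1 w3 w4] K4_exclusive[of v w1 w2 w4] V by auto
  moreover have "\<not> meets w1 w3 a w2" "\<not> meets w2 w4 v w3"
    using chain_crossings[of v a w1 w2 w3 u w] chain_crossings[of v a w2 w3 w4 u w] V ref b by auto
  moreover have "\<not> meets a w2 v w1" "\<not> meets a w2 v w3" "\<not> meets a w4 v w1" "\<not> meets a w4 v w3"
    using crossing_edges_legs_disjoint[of v a w1 w2] crossing_edges_legs_disjoint[of v a w2 w3]
      crossing_edges_legs_disjoint[of v a w1 w4] crossing_edges_legs_disjoint[of v a w3 w4] V mt by simp_all
  \<comment> \<open>With respect to the triangle \<open>v w1 w3\<close>, the edges
    \<open>a w2\<close> and \<open>a w4\<close> cross no side, so \<open>w2\<close> and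
    \<open>w4\<close> are both on the side of \<open>a\<close>. But \<open>w2 w4\<close> crosses
    \<open>w1 w3\<close> and neither of the other two sides.\<close>
  ultimately show False
    using triangle_parity[of v w1 w3 a w2] triangle_parity[of v w1 w3 a w4] triangle_parity[of v w1 w3 w2 w4]
      V cr meets_commute(1)[of w1 w3] meets_commute(3)[of _ _ v w3]
    by auto
qed

lemma interlaced_chain_edges_disjoint:
  assumes V: "{v, a, w1, w2, w3, w4} \<subseteq> V" "distinct [v, a, w1, w2, w3, w4]"
    and ref: "reference_pair v a u w"
    and b: "below v a u w1 w2" "below v a u w1 w3" "below v a u w1 w4"
      "below v a u w2 w3" "below v a u w2 w4" "below v a u w3 w4"
  shows "\<not> meets w1 w3 w2 w4"
proof -
  obtain q12 q34 where q: "q12 \<in> edge w1 w2" "q12 \<in> edge v a" "q34 \<in> edge w3 w4" "q34 \<in> edge v a"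
    using b by (auto simp: below_def meets_def)
  have "arc_between (edge v a) v a" "q12 \<noteq> v" "q12 \<noteq> a"
    using V edge_arc_between q vertex_notin_edge[of w1 w2] by auto
  then obtain A1 A2 where A: "arc_between A1 v q12" "arc_between A2 q12 a" "A1 \<union> A2 = edge v a" "A1 \<inter> A2 = {q12}"
    using arc_between_split[of "edge v a" v a q12] q by metis
  then consider "q34 \<in> A2" | "q34 \<in> A1"
    using q by blast
  then show ?thesis
  proof cases
    case 1
    then show ?thesis
      using interlaced_chain_edges_disjoint_aux[OF V ref b q(1,3) A] by blast
  next
    case 2
    show ?thesis
    proof (rule interlaced_chain_edges_disjoint_aux)
      show "reference_pair a v u w"
        using ref by (rule reference_pair_swap)
      show "arc_between A2 a q12" "arc_between A1 q12 v"
        using A arc_between_sym by auto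
      show "A2 \<union> A1 = edge a v" "A2 \<inter> A1 = {q12}"
        using A by (auto simp: edge_commute)
    qed (use V b below_swap q 2 in auto)
  qed
qed

end

section \<open>Plane paths\<close>

text \<open>A form of Mirsky's theorem: the set \<open>M\<close> of minimal elements is peeled off.
  A chain in the rest extends downwards by one element; otherwise the larger of \<open>M\<close> and
  the antichain found in the rest is large enough.\<close>

lemma long_chain_or_large_antichain:
  fixes P :: "'a \<Rightarrow> 'a \<Rightarrow> bool"
  assumes "finite S" and trans: "\<And>x y z. \<lbrakk>x \<in> S; y \<in> S; z \<in> S; P x y; P y z\<rbrakk> \<Longrightarrow> P x z"
    and irrefl: "\<And>x. \<not> P x x"
  shows "(\<exists>xs. sorted_wrt P xs \<and> set xs \<subseteq> S \<and> length xs = t) \<or>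
    (\<exists>A\<subseteq>S. (\<forall>x\<in>A. \<forall>y\<in>A. \<not> P x y) \<and> card S \<le> t * card A)"
  using assms(1,2)
proof (induction t arbitrary: S)
  case 0
  then show ?case
    by (intro disjI1 exI[of _ "[]"]) auto
next
  case (Suc t)
  define M where "M = {x \<in> S. \<forall>y\<in>S. \<not> P y x}"
  have M: "M \<subseteq> S" "\<forall>x\<in>M. \<forall>y\<in>M. \<not> P x y"
    by (auto simp: M_def)
  have "(\<exists>xs. sorted_wrt P xs \<and> set xs \<subseteq> S - M \<and> length xs = t) \<or>
    (\<exists>A\<subseteq>S - M. (\<forall>x\<in>A. \<forall>y\<in>A. \<not> P x y) \<and> card (S - M) \<le> t * card A)"
  proof (rule Suc.IH)
    show "P x z" if "x \<in> S - M" "y \<in> S - M" "z \<in> S - M" "P x y" "P y z" for x y z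
      using Suc.prems(2)[of x y z] that by blast
  qed (use Suc.prems in auto)
  then show ?case
  proof (elim disjE exE conjE)
    fix xs assume xs: "sorted_wrt P xs" "set xs \<subseteq> S - M" "length xs = t"
    show ?thesis
    proof (cases xs)
      case Nil
      \<comment> \<open>Here \<open>t = 0\<close>, and any element of \<open>S\<close> is a chain of
        length one; for empty \<open>S\<close> the empty antichain does.\<close>
      show ?thesis
      proof (cases "S = {}")
        case True
        then show ?thesis by auto
      next
        case False
        then obtain x where "x \<in> S" by blast
        then show ?thesis
          using Nil xs by (intro disjI1 exI[of _ "[x]"]) auto
      qed
    next
      case (Cons x ys)
      then have x: "x \<in> S" "x \<notin> M"
        using xs by auto
      then obtain y where y: "y \<in> S" "P y x"
        by (auto simp: M_def)
      have "P y z" if "z \<in> set ys" for z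
        using Suc.prems(2)[of y x z] x y xs Cons that by auto
      then have "sorted_wrt P (y # xs)"
        using xs(1) Cons y by auto
      then show ?thesis
        using xs y by (intro disjI1 exI[of _ "y # xs"]) auto
    qed
  next
    fix A assume A: "A \<subseteq> S - M" "\<forall>x\<in>A. \<forall>y\<in>A. \<not> P x y" "card (S - M) \<le> t * card A"
    have S: "card S = card (S - M) + card M"
      using Suc.prems(1) M(1) by (metis card_Diff_subset card_mono finite_subset le_add_diff_inverse2)
    show ?thesis
    proof (cases "card A \<le> card M")
      case True
      then have "t * card A \<le> t * card M"
        by simp
      then have "card S \<le> t * card M + card M"
        using A(3) S by linarith
      then show ?thesis
        using M by (intro disjI2 exI[of _ M]) auto
    next
      case False
      then have "card S \<le> Suc t * card A"
        using A(3) S by auto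
      then show ?thesis
        using A by (intro disjI2 exI[of _ A]) auto
    qed
  qed
qed

section \<open>Plane paths from chains, and independent sets without long chains\<close>

context complete_simple_topological_graph
begin

text \<open>Consecutive edges need no check: they share only a vertex, which is not an interior
  point of either arc.\<close>

lemma plane_pathI:
  assumes vs: "vs \<noteq> []" "distinct vs" "set vs \<subseteq> V"
    and disj: "\<And>i j. \<lbrakk>Suc i < j; Suc j < length vs\<rbrakk> \<Longrightarrow>
      \<not> meets (vs ! i) (vs ! Suc i) (vs ! j) (vs ! Suc j)"
  shows "plane_path V (complete_edges V) \<gamma> vs"
proof -
  have mem: "vs ! i \<in> V" if "i < length vs" for i
    using vs(3) that by auto
  have neq: "vs ! i \<noteq> vs ! j" if "i < length vs" "j < length vs" "i \<noteq> j" for i j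
    using vs(2) that by (simp add: nth_eq_iff_index_eq)
  have no_cross: "\<not> cross (\<gamma> {vs ! i, vs ! Suc i}) (\<gamma> {vs ! j, vs ! Suc j})"
    if ij: "i < j" "Suc j < length vs" for i j
  proof
    assume "cross (\<gamma> {vs ! i, vs ! Suc i}) (\<gamma> {vs ! j, vs ! Suc j})"
    then obtain p where p: "p \<in> arc_interior (\<gamma> {vs ! i, vs ! Suc i})" "p \<in> arc_interior (\<gamma> {vs ! j, vs ! Suc j})"
      by (auto simp: cross_def properly_cross_at_def)
    then have pe: "p \<in> edge (vs ! i) (vs ! Suc i)" "p \<in> edge (vs ! j) (vs ! Suc j)"
      by (auto simp: arc_interior_def edge_def)
    show False
    proof (cases "j = Suc i")
      case True
      have "p = vs ! Suc i"
        using edge_inter_adjacent[of "vs ! i" "vs ! Suc i" "vs ! Suc (Suc i)"] pe True ij mem neq by auto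
      moreover have "p \<notin> {vs ! i, vs ! Suc i}"
        using p(1) endpoints_edge[OF mem_complete_edges, of "vs ! i" "vs ! Suc i"] ij mem neq
        by (auto simp: arc_interior_def)
      ultimately show False
        by simp
    next
      case False
      then show False
        using disj[of i j] ij pe by (auto simp: meets_def)
    qed
  qed
  have sym: "cross g h \<Longrightarrow> cross h g" for g h
    unfolding cross_def using properly_cross_at_sym by blast
  have "path_edges vs \<subseteq> complete_edges V"
    using mem neq by (auto simp: path_edges_def intro!: mem_complete_edges)
  moreover have "\<not> cross (\<gamma> e) (\<gamma> f)" if ef: "e \<in> path_edges vs" "f \<in> path_edges vs" "e \<noteq> f" for e f
  proof -
    obtain i j where ij: "e = {vs ! i, vs ! Suc i}" "f = {vs ! j, vs ! Suc j}" "Suc i < length vs" "Suc j < length vs"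
      using ef by (auto simp: path_edges_def)
    then have "i < j \<or> j < i"
      using ef(3) by (metis linorder_neqE_nat)
    then show ?thesis
      using no_cross ij sym by blast
  qed
  ultimately show ?thesis
    using vs by (auto simp: plane_path_def graph_path_def)
qed

lemma plane_path_of_chain:
  assumes V: "{v, a} \<subseteq> V" "v \<noteq> a" and ref: "reference_pair v a u w"
    and xs: "sorted_wrt (below v a u) xs" "set xs \<subseteq> V - {v, a}" "length xs = 2 * m" and "0 < m"
  shows "\<exists>vs. plane_path V (complete_edges V) \<gamma> vs \<and> length vs = 2 * m"
proof -
  have below: "below v a u (xs ! i) (xs ! j)" if "i < j" "j < 2 * m" for i j
    using xs that by (simp add: sorted_wrt_nth_less)
  have mem: "xs ! i \<in> V - {v, a}" if "i < 2 * m" for i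
    using xs that by (metis nth_mem subsetD)
  have neq: "xs ! i \<noteq> xs ! j" if "i < j" "j < 2 * m" for i j
    using below[OF that] by (simp add: below_def)
  \<comment> \<open>Even positions of the zigzag run through the first half of the chain, odd
    positions through the second.\<close>
  define f where "f j = (if even j then j div 2 else m + j div 2)" for j
  define vs where "vs = map (\<lambda>j. xs ! f j) [0..<2 * m]"
  have vs: "length vs = 2 * m" "\<And>j. j < 2 * m \<Longrightarrow> vs ! j = xs ! f j"
    by (simp_all add: vs_def)
  have f: "f j < 2 * m" if "j < 2 * m" for j
    using that by (auto simp: f_def)
  have finj: "i = j" if "f i = f j" "i < 2 * m" "j < 2 * m" for i j
    using that by (auto simp: f_def elim!: evenE oddE split: if_splits)
  have "plane_path V (complete_edges V) \<gamma> vs"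
  proof (rule plane_pathI)
    show "vs \<noteq> []"
      using vs(1) \<open>0 < m\<close> by auto
    show "distinct vs"
      unfolding distinct_conv_nth
    proof (intro allI impI)
      fix i j assume ij: "i < length vs" "j < length vs" "i \<noteq> j"
      then have "f i \<noteq> f j"
        using finj vs(1) by auto
      then show "vs ! i \<noteq> vs ! j"
        using neq[of "f i" "f j"] neq[of "f j" "f i"] f ij vs by (metis linorder_neqE_nat)
    qed
    show "set vs \<subseteq> V"
      using mem f by (auto simp: vs_def)
    show "\<not> meets (vs ! i) (vs ! Suc i) (vs ! j) (vs ! Suc j)" if ij: "Suc i < j" "Suc j < length vs" for i j
    proof -
      \<comment> \<open>The \<open>k\<close>-th edge of the zigzag joins the chain elements with
        indices \<open>p k\<close> in the first half and \<open>q k\<close> in the second. Since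
        \<open>i + 2 \<le> j\<close>, both indices strictly increase from \<open>i\<close> to
        \<open>j\<close>, so the two edges are interlaced.\<close>
      define p q where "p k = (k + 1) div 2" and "q k = m + k div 2" for k
      have ordering: "p i < p j" "p j < q i" "q i < q j" "q j < 2 * m"
        using ij vs(1) by (auto simp: p_def q_def)
      have disjoint: "\<not> meets (xs ! p i) (xs ! q i) (xs ! p j) (xs ! q j)"
      proof (rule interlaced_chain_edges_disjoint[OF _ _ ref])
        show "{v, a, xs ! p i, xs ! p j, xs ! q i, xs ! q j} \<subseteq> V"
          "distinct [v, a, xs ! p i, xs ! p j, xs ! q i, xs ! q j]"
          using V mem[of "p i"] mem[of "p j"] mem[of "q i"] mem[of "q j"] ordering
            neq[of "p i" "p j"] neq[of "p i" "q i"] neq[of "p i" "q j"] neq[of "p j" "q i"]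
            neq[of "p j" "q j"] neq[of "q i" "q j"]
          by auto
      qed (use ordering below in auto)
      have vs_edge: "vs ! k = xs ! p k \<and> vs ! Suc k = xs ! q k \<or> vs ! k = xs ! q k \<and> vs ! Suc k = xs ! p k"
        if "Suc k < 2 * m" for k
        using that vs(2)[of k] vs(2)[of "Suc k"] by (auto simp: f_def p_def q_def elim!: evenE oddE)
      have "vs ! i = xs ! p i \<and> vs ! Suc i = xs ! q i \<or> vs ! i = xs ! q i \<and> vs ! Suc i = xs ! p i"
        "vs ! j = xs ! p j \<and> vs ! Suc j = xs ! q j \<or> vs ! j = xs ! q j \<and> vs ! Suc j = xs ! p j"
        using vs_edge[of i] vs_edge[of j] ij vs(1) by auto
      then show ?thesis
        using disjoint meets_commute(2)[of "xs ! p i" "xs ! q i"] meets_commute(3)[of _ _ "xs ! p j" "xs ! q j"]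
        by (elim disjE) auto
    qed
  qed
  then show ?thesis
    using vs(1) by blast
qed

text \<open>An edge within \<open>S\<close> that crosses \<open>v a\<close> supplies the reference
  pair, and the dichotomy for \<open>below\<close> with chain length \<open>2 * m\<close> applies.
  If there is no such edge, \<open>S\<close> itself is independent.\<close>

lemma independent_or_plane_path:
  assumes V: "{v, a} \<subseteq> V" "v \<noteq> a" and S: "S \<subseteq> V - {v, a}" and "0 < m"
  shows "(\<exists>vs. plane_path V (complete_edges V) \<gamma> vs \<and> length vs = 2 * m) \<or>
    (\<exists>A\<subseteq>S. (\<forall>x\<in>A. \<forall>y\<in>A. x \<noteq> y \<longrightarrow> \<not> meets x y v a) \<and> card S \<le> 2 * m * card A)"
proof (cases "\<exists>k\<in>S. \<exists>l\<in>S. k \<noteq> l \<and> meets k l v a")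
  case True
  then obtain k l where kl: "k \<in> S" "l \<in> S" "k \<noteq> l" "meets k l v a"
    by blast
  have "{v, a, k, l} \<subseteq> V" "distinct [v, a, k, l]"
    using kl V S by auto
  then obtain u w where "\<And>n. n \<in> V - {v, a} \<Longrightarrow> u \<notin> triangle v a n \<and> w \<notin> triangle v a n \<and>
      (u \<in> inside (triangle v a n) \<longleftrightarrow> w \<notin> inside (triangle v a n))"
    using reference_points[OF _ _ kl(4)] by metis
  then have ref: "reference_pair v a u w"
    unfolding reference_pair_def by blast
  have fin: "finite S"
    using S finite_vertices finite_subset by blast
  have "(\<exists>xs. sorted_wrt (below v a u) xs \<and> set xs \<subseteq> S \<and> length xs = 2 * m) \<or>
    (\<exists>A\<subseteq>S. (\<forall>x\<in>A. \<forall>y\<in>A. \<not> below v a u x y) \<and> card S \<le> 2 * m * card A)"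
  proof (rule long_chain_or_large_antichain[OF fin])
    show "below v a u x z" if "x \<in> S" "y \<in> S" "z \<in> S" "below v a u x y" "below v a u y z" for x y z
      using below_trans[OF _ V(2) _ ref that(4,5)] that(1-3) S V by blast
  qed (simp add: below_def)
  then show ?thesis
  proof (elim disjE exE conjE)
    fix xs assume "sorted_wrt (below v a u) xs" "set xs \<subseteq> S" "length xs = 2 * m"
    then have "\<exists>vs. plane_path V (complete_edges V) \<gamma> vs \<and> length vs = 2 * m"
      using S \<open>0 < m\<close> by (intro plane_path_of_chain[OF V ref, of xs m]) auto
    then show ?thesis ..
  next
    fix A assume A: "A \<subseteq> S" "\<forall>x\<in>A. \<forall>y\<in>A. \<not> below v a u x y" "card S \<le> 2 * m * card A"
    have "\<not> meets x y v a" if "x \<in> A" "y \<in> A" "x \<noteq> y" for x y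
    proof
      assume "meets x y v a"
      moreover have "{v, a, x, y} \<subseteq> V" "distinct [v, a, x, y]"
        using that A(1) S V by auto
      ultimately show False
        using below_total[OF _ _ ref, of x y] A(2) that by blast
    qed
    then show ?thesis
      using A by blast
  qed
next
  case False
  have "card S \<le> 2 * m * card S"
    using \<open>0 < m\<close> by (cases m) auto
  then show ?thesis
    using False by (intro disjI2 exI[of _ S]) blast
qed

section \<open>The greedy construction\<close>

text \<open>The clause that edges among \<open>bs\<close> do not cross \<open>v a\<close> is carried
  for the induction: it is the hypothesis that the preceding step needs for the parity argument.
  Each step costs a factor \<open>t\<close> for independence, and the factor 4 pays for the choice
  of a side and the loss of \<open>b\<close>.\<close>

lemma greedy_plane_path:
  assumes "v \<in> V" "0 < t"
    and independent: "\<And>a S. \<lbrakk>a \<in> V - {v}; S \<subseteq> V - {v, a}\<rbrakk> \<Longrightarrow>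
      \<exists>A\<subseteq>S. (\<forall>x\<in>A. \<forall>y\<in>A. x \<noteq> y \<longrightarrow> \<not> meets x y v a) \<and> card S \<le> t * card A"
  shows "\<lbrakk>a \<in> V - {v}; S \<subseteq> V - {v, a}; (4 * t) ^ r \<le> card S\<rbrakk> \<Longrightarrow>
    \<exists>bs. length bs = r \<and> distinct bs \<and> set bs \<subseteq> S \<and>
      (\<forall>x\<in>set bs. \<forall>y\<in>set bs. x \<noteq> y \<longrightarrow> \<not> meets x y v a) \<and>
      (\<forall>i j. Suc i < j \<longrightarrow> Suc j < length (a # bs) \<longrightarrow>
        \<not> meets ((a # bs) ! i) ((a # bs) ! Suc i) ((a # bs) ! j) ((a # bs) ! Suc j))"
proof (induction r arbitrary: a S)
  case 0
  then show ?case
    by (intro exI[of _ "[]"]) auto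
next
  case (Suc r)
  define M where "M = (4 * t) ^ r"
  have "1 \<le> M"
    using \<open>0 < t\<close> by (simp add: M_def)
  obtain A where A: "A \<subseteq> S" "\<And>x y. \<lbrakk>x \<in> A; y \<in> A; x \<noteq> y\<rbrakk> \<Longrightarrow> \<not> meets x y v a" "card S \<le> t * card A"
    using independent[OF Suc.prems(1,2)] by blast
  have finA: "finite A"
    using A(1) Suc.prems(2) finite_vertices by (meson finite_Diff finite_subset)
  have "t * (4 * M) = (4 * t) ^ Suc r"
    by (simp add: M_def)
  then have "t * (4 * M) \<le> t * card A"
    using Suc.prems(3) A(3) by linarith
  then have cA: "4 * M \<le> card A"
    using \<open>0 < t\<close> by simp
  then obtain b where b: "b \<in> A"
    using \<open>1 \<le> M\<close> by (cases "A = {}") auto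
  define T where "T = triangle v a b"
  define I where "I = {x \<in> A - {b}. x \<in> inside T}"
  define O' where "O' = {x \<in> A - {b}. x \<notin> inside T}"
  have "card (A - {b}) = card I + card O'"
    using finA by (subst card_Un_disjoint[symmetric]) (auto simp: I_def O'_def intro!: arg_cong[of _ _ card])
  \<comment> \<open>At least \<open>4 * M - 1\<close> vertices remain without \<open>b\<close>, and
    \<open>M \<ge> 1\<close>.\<close>
  then have "M \<le> card I \<or> M \<le> card O'"
    using cA b finA \<open>1 \<le> M\<close> by auto
  then have "\<exists>S'\<subseteq>A - {b}. M \<le> card S' \<and> (\<forall>x\<in>S'. \<forall>y\<in>S'. x \<in> inside T \<longleftrightarrow> y \<in> inside T)"
  proof
    assume "M \<le> card I"
    then show ?thesis
      by (intro exI[of _ I]) (auto simp: I_def)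
  next
    assume "M \<le> card O'"
    then show ?thesis
      by (intro exI[of _ O']) (auto simp: O'_def)
  qed
  then obtain S' where S': "S' \<subseteq> A - {b}" "M \<le> card S'"
    "\<And>x y. \<lbrakk>x \<in> S'; y \<in> S'\<rbrakk> \<Longrightarrow> x \<in> inside T \<longleftrightarrow> y \<in> inside T"
    by blast
  have "b \<in> V - {v}" "S' \<subseteq> V - {v, b}"
    using b S' A(1) Suc.prems by auto
  from Suc.IH[OF this] S'(2) obtain bs where bs: "length bs = r" "distinct bs" "set bs \<subseteq> S'"
    and bs_star: "\<And>x y. \<lbrakk>x \<in> set bs; y \<in> set bs; x \<noteq> y\<rbrakk> \<Longrightarrow> \<not> meets x y v b"
    and bs_plane: "\<And>i j. \<lbrakk>Suc i < j; Suc j < length (b # bs)\<rbrakk> \<Longrightarrow>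
        \<not> meets ((b # bs) ! i) ((b # bs) ! Suc i) ((b # bs) ! j) ((b # bs) ! Suc j)"
    unfolding M_def by metis
  \<comment> \<open>\<open>x y\<close> crosses neither \<open>v a\<close>, by independence of
    \<open>A\<close>, nor \<open>v b\<close>, by the induction hypothesis, and its ends lie on the
    same side of \<open>v a b\<close>; parity excludes a crossing with \<open>a b\<close>.\<close>
  have first: "\<not> meets a b x y" if "x \<in> set bs" "y \<in> set bs" "x \<noteq> y" for x y
  proof -
    have xy: "x \<in> A" "y \<in> A" "x \<noteq> b" "y \<noteq> b" "x \<in> inside T \<longleftrightarrow> y \<in> inside T"
      using that bs(3) S'(1) S'(3)[of x y] by auto
    have "{v, a, b, x, y} \<subseteq> V" "distinct [v, a, b, x, y]"
      using xy b that A(1) Suc.prems \<open>v \<in> V\<close> by auto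
    from triangle_parity[OF this] show ?thesis
      using xy A(2)[of x y] bs_star[OF that] that(3) meets_commute(3)[of x y b v] meets_commute(1)[of x y a b]
      by (auto simp: T_def)
  qed
  have "\<not> meets ((a # b # bs) ! i) ((a # b # bs) ! Suc i) ((a # b # bs) ! j) ((a # b # bs) ! Suc j)"
    if ij: "Suc i < j" "Suc j < length (a # b # bs)" for i j
  proof (cases i)
    case 0
    obtain j' where j: "j = Suc (Suc j')"
      using ij(1) by (metis Suc_lessE less_eq_Suc_le Suc_le_D)
    have "bs ! j' \<noteq> bs ! Suc j'"
      using bs(2) ij j by (simp add: nth_eq_iff_index_eq)
    then show ?thesis
      using first[of "bs ! j'" "bs ! Suc j'"] ij 0 j by simp
  next
    case (Suc i')
    then obtain j' where "j = Suc j'"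
      using ij by (cases j) auto
    then show ?thesis
      using bs_plane[of i' j'] ij Suc by simp
  qed
  moreover have "length (b # bs) = Suc r" "distinct (b # bs)" "set (b # bs) \<subseteq> A"
    using bs S'(1) b by auto
  ultimately show ?case
    using A(1,2) by (intro exI[of _ "b # bs"]) blast
qed

text \<open>A zigzag on \<open>2 * r\<close> vertices has \<open>2 * r - 1 \<ge> r\<close> edges. If
  there is none, independent sets exist throughout with \<open>t = 2 * r\<close>, so that
  \<open>4 * t = 8 * r\<close>; the summand 2 accounts for \<open>v\<close> and
  \<open>a\<close>.\<close>

lemma plane_path_exists:
  assumes "0 < r" "(8 * r) ^ r + 2 \<le> card V"
  shows "\<exists>vs. plane_path V (complete_edges V) \<gamma> vs \<and> r \<le> graph_path_length vs"
proof (cases "\<exists>vs. plane_path V (complete_edges V) \<gamma> vs \<and> length vs = 2 * r")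
  case True
  then show ?thesis
    using \<open>0 < r\<close> by (force simp: graph_path_length_def)
next
  case False
  have "1 < card V"
    using assms(2) by linarith
  then obtain v a where va: "v \<in> V" "a \<in> V" "v \<noteq> a"
    by (metis card_le_Suc0_iff_eq card.infinite le_numeral_extra(4) less_nat_zero_code not_less One_nat_def)
  have "card (V - {v, a}) = card V - 2"
    using va by (simp add: card_Diff_subset)
  then have card: "(4 * (2 * r)) ^ r \<le> card (V - {v, a})"
    using assms(2) by simp
  have "\<exists>bs. length bs = r \<and> distinct bs \<and> set bs \<subseteq> V - {v, a} \<and>
      (\<forall>x\<in>set bs. \<forall>y\<in>set bs. x \<noteq> y \<longrightarrow> \<not> meets x y v a) \<and>
      (\<forall>i j. Suc i < j \<longrightarrow> Suc j < length (a # bs) \<longrightarrow>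
        \<not> meets ((a # bs) ! i) ((a # bs) ! Suc i) ((a # bs) ! j) ((a # bs) ! Suc j))"
  proof (rule greedy_plane_path[OF va(1) _ _ _ subset_refl card])
    show "\<exists>A\<subseteq>S. (\<forall>x\<in>A. \<forall>y\<in>A. x \<noteq> y \<longrightarrow> \<not> meets x y v b) \<and> card S \<le> 2 * r * card A"
      if "b \<in> V - {v}" "S \<subseteq> V - {v, b}" for b S
      using independent_or_plane_path[of v b S r] that va False \<open>0 < r\<close> by auto
  qed (use va \<open>0 < r\<close> in auto)
  then obtain bs where bs: "length bs = r" "distinct bs" "set bs \<subseteq> V - {v, a}"
    and "\<And>i j. \<lbrakk>Suc i < j; Suc j < length (a # bs)\<rbrakk> \<Longrightarrow>
        \<not> meets ((a # bs) ! i) ((a # bs) ! Suc i) ((a # bs) ! j) ((a # bs) ! Suc j)"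
    by blast
  then have "plane_path V (complete_edges V) \<gamma> (a # bs)"
    using va by (intro plane_pathI) auto
  then show ?thesis
    using bs(1) by (intro exI[of _ "a # bs"]) (simp add: graph_path_length_def)
qed

end

section \<open>The length guaranteed on \<open>n\<close> vertices and its asymptotics\<close>

text \<open>With \<open>L = log 2 n\<close>, a positive integer
  \<open>r \<le> L / (4 + log 2 L)\<close> satisfies \<open>r * (3 + log 2 r) \<le> L - 1\<close>,
  that is \<open>(8 * r) ^ r \<le> n / 2\<close>. Of the constant 4, three units absorb the factor 8
  and one provides the halving.\<close>

definition path_bound :: "nat \<Rightarrow> nat" where
  "path_bound n = nat \<lfloor>log 2 n / (4 + log 2 (log 2 n))\<rfloor>"

lemma path_bound_power_le:
  assumes "2 \<le> n" "0 < path_bound n"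
  shows "(8 * path_bound n) ^ path_bound n + 2 \<le> n"
proof -
  define L where "L = log 2 (real n)"
  define r where "r = path_bound n"
  have "1 \<le> L"
    unfolding L_def using assms(1) by (simp add: le_log_iff)
  then have lL: "0 \<le> log 2 L"
    by simp
  have r: "1 \<le> real r" "real r \<le> L / (4 + log 2 L)"
    using assms(2) \<open>1 \<le> L\<close> lL unfolding r_def path_bound_def L_def by (auto simp: of_nat_nat)
  have rL: "real r * (4 + log 2 L) \<le> L"
    using r(2) lL by (simp add: field_simps)
  have "real r * 4 \<le> real r * (4 + log 2 L)"
    using lL by (intro mult_left_mono) auto
  then have "4 * real r \<le> L"
    using rL by linarith
  have "real ((8 * r) ^ r) = (8 * real r) powr real r"
    using r(1) by (simp add: powr_realpow)
  also have "\<dots> = (2 powr log 2 (8 * real r)) powr real r"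
    using r(1) by simp
  also have "\<dots> = 2 powr (real r * log 2 (8 * real r))"
    by (simp only: powr_powr mult.commute)
  also have "log 2 (8 * real r) = 3 + log 2 (real r)"
    using r(1) log_mult[of 2 8 "real r"] log_pow_cancel[of 2 3] by simp
  also have "2 powr (real r * (3 + log 2 (real r))) \<le> 2 powr (L - 1)"
  proof (rule powr_mono)
    have "log 2 (real r) \<le> log 2 L"
      using r(1) \<open>4 * real r \<le> L\<close> by (intro log_mono) auto
    then have "real r * (3 + log 2 (real r)) \<le> real r * (3 + log 2 L)"
      by (intro mult_left_mono) auto
    also have "\<dots> \<le> L - 1"
      using rL r(1) by (simp add: algebra_simps)
    finally show "real r * (3 + log 2 (real r)) \<le> L - 1" .
  qed simp
  also have "\<dots> = real n / 2"
    using assms(1) by (simp add: L_def powr_diff)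
  finally have "2 * (8 * r) ^ r \<le> n"
    by linarith
  \<comment> \<open>Together with the factor 2 gained above, this makes room for the summand
    2.\<close>
  moreover have "2 \<le> (8 * r) ^ r"
  proof -
    have "(8 * r) ^ 1 \<le> (8 * r) ^ r"
      using r(1) by (intro power_increasing) auto
    then show ?thesis
      using r(1) by simp
  qed
  ultimately show ?thesis
    unfolding r_def by linarith
qed

text \<open>The sequence is the exponent deficit for which \<open>log 2 n\<close> raised to one
  minus it equals \<open>max 1 (path_bound n)\<close>, cut off below at 0. It tends to 0 because
  dividing by \<open>4 + log 2 (log 2 n)\<close> lowers the logarithm only by a lower-order
  term.\<close>

lemma path_bound_exponent:
  "(\<lambda>n. max 0 (1 - ln (max 1 (real (path_bound n))) / ln (log 2 (real n)))) \<longlonglongrightarrow> 0"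
proof -
  let ?f = "\<lambda>n. max 0 (1 - ln (max 1 (real (path_bound n))) / ln (log 2 (real n)))"
  let ?g = "\<lambda>n. 1 - ln (log 2 (real n) / (4 + log 2 (log 2 (real n))) - 1) / ln (log 2 (real n))"
  have "?g \<longlonglongrightarrow> 0"
    by real_asymp
  then have g: "(\<lambda>n. max 0 (?g n)) \<longlonglongrightarrow> 0"
    using tendsto_max[OF tendsto_const[of 0]] by fastforce
  have "eventually (\<lambda>n. log 2 (real n) / (4 + log 2 (log 2 (real n))) - 1 > 0) sequentially"
    by real_asymp
  moreover have "eventually (\<lambda>n. ln (log 2 (real n)) > 0) sequentially"
    by real_asymp
  ultimately have fg: "eventually (\<lambda>n. ?f n \<le> max 0 (?g n)) sequentially"
  proof eventually_elim
    case (elim n)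
    let ?x = "log 2 (real n) / (4 + log 2 (log 2 (real n)))"
    \<comment> \<open>Rounding down costs at most 1, which explains the shift in
      \<open>?g\<close>.\<close>
    have "?x - 1 \<le> max 1 (real (path_bound n))"
      unfolding path_bound_def by linarith
    then have "ln (?x - 1) \<le> ln (max 1 (real (path_bound n)))"
      using elim by (subst ln_le_cancel_iff) auto
    then have "ln (?x - 1) / ln (log 2 (real n)) \<le> ln (max 1 (real (path_bound n))) / ln (log 2 (real n))"
      using elim by (intro divide_right_mono) auto
    then show ?case
      by linarith
  qed
  show ?thesis
    by (rule tendsto_sandwich[OF _ fg tendsto_const g]) auto
qed

theorem theorem3:
  "\<exists>\<epsilon> :: nat \<Rightarrow> real. \<epsilon> \<longlonglongrightarrow> 0 \<and>
     (\<forall>n \<ge> 2. \<forall>V E \<gamma>. simple_topological_graph V E \<gamma> \<longrightarrow> E = complete_edges V \<longrightarrow> card V = n \<longrightarrow>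
        (\<exists>vs. plane_path V E \<gamma> vs \<and>
              real (graph_path_length vs) \<ge> log 2 (real n) powr (1 - \<epsilon> n)))"
proof (rule exI[of _ "\<lambda>n. max 0 (1 - ln (max 1 (real (path_bound n))) / ln (log 2 (real n)))"],
    intro conjI allI impI)
  let ?\<epsilon> = "\<lambda>n. max 0 (1 - ln (max 1 (real (path_bound n))) / ln (log 2 (real n)))"
  show "?\<epsilon> \<longlonglongrightarrow> 0"
    by (rule path_bound_exponent)
  fix n :: nat and V E \<gamma>
  assume n: "2 \<le> n" and G: "simple_topological_graph V E \<gamma>" "E = complete_edges V" "card V = n"
  interpret complete_simple_topological_graph V \<gamma>
    unfolding complete_simple_topological_graph_def using G by simp
  define L where "L = log 2 (real n)"
  define R where "R = max 1 (real (path_bound n))"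
  have "1 \<le> L"
    unfolding L_def using n by (simp add: le_log_iff)
  have "L powr (1 - ?\<epsilon> n) \<le> R"
  \<comment> \<open>For \<open>n = 2\<close> one has \<open>L = 1\<close> and
    \<open>ln L = 0\<close>, so the quotient in the exponent is meaningless, but every power of 1 is
    1.\<close>
  proof (cases "L = 1")
    case False
    then have "0 < ln L"
      using \<open>1 \<le> L\<close> by simp
    \<comment> \<open>The cut-off at 0 only increases \<open>?\<epsilon> n\<close>, so
      \<open>1 - ?\<epsilon> n \<le> ln R / ln L\<close>.\<close>
    have "(1 - ?\<epsilon> n) * ln L \<le> ln R / ln L * ln L"
      using \<open>0 < ln L\<close> unfolding R_def L_def by (intro mult_right_mono) auto
    then have "exp ((1 - ?\<epsilon> n) * ln L) \<le> exp (ln R)"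
      using \<open>0 < ln L\<close> by simp
    then show ?thesis
      using \<open>1 \<le> L\<close> by (simp add: powr_def R_def)
  qed (simp add: R_def)
  moreover have "\<exists>vs. plane_path V E \<gamma> vs \<and> R \<le> real (graph_path_length vs)"
  proof (cases "path_bound n = 0")
    \<comment> \<open>Then \<open>R = 1\<close>, and a single edge is long enough.\<close>
    case True
    have "1 < card V"
      using n G(3) by simp
    then obtain x y where "x \<in> V" "y \<in> V" "x \<noteq> y"
      by (metis card_le_Suc0_iff_eq finite_vertices not_less One_nat_def)
    then have "plane_path V (complete_edges V) \<gamma> [x, y]"
      by (intro plane_pathI) auto
    then show ?thesis
      using True G(2) by (intro exI[of _ "[x, y]"]) (simp add: R_def graph_path_length_def)
  next
    case False
    then show ?thesis
      using plane_path_exists[of "path_bound n"] path_bound_power_le[OF n] G unfolding R_def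
      by (auto simp: le_max_iff_disj)
  qed
  ultimately show "\<exists>vs. plane_path V E \<gamma> vs \<and> log 2 (real n) powr (1 - ?\<epsilon> n) \<le> real (graph_path_length vs)"
    unfolding L_def by (meson order_trans)
qed

end
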